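(* Suppose that one among the hypotheses (WWD), (WSD), (SWD) of the context holds, with $K_1+K_2\le2$. Then there exists a constant $C>0$ such that $$\int_0^1\frac{u^2}{b}\,dx\le C\int_0^1a(u')^2\,dx$$ for every $u\in H^1_{a,b}(0,1)$.
   Context: Degeneracy hypotheses. Each of the following assumes that there is $x_0\in(0,1)$ with $a(x_0)=b(x_0)=0$, $a,b>0$ on $[0,1]\setminus\{x_0\}$, and constants $K_1,K_2$ with $(x-x_0)a'\le K_1a$ and $(x-x_0)b'\le K_2b$ a.e. in $[0,1]$. In addition: (WWD) $a,b\in W^{1,1}(0,1)$, $K_1,K_2\in(0,1)$; (WSD) $a\in W^{1,1}(0,1)$, $b\in W^{1,\infty}(0,1)$, $K_1\in(0,1)$, $K_2\ge1$; (SWD) $a\in W^{1,\infty}(0,1)$, $b\in W^{1,1}(0,1)$, $K_1\ge1$, $K_2\in(0,1)$. Spaces. $H^1_a(0,1)=\{u\in W^{1,1}_0(0,1):\sqrt a\,u'\in L^2(0,1)\}$ and $H^1_{a,b}(0,1)=\{u\in H^1_a(0,1): u/\sqrt b\in L^2(0,1)\}$. *)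

theory Defs
  imports "HOL-Analysis.Analysis"
begin

text \<open>
  Functions on the interval (0,1) are total functions on the reals; only their values on the
  interval matter. Members of the Lebesgue and Sobolev spaces below are representatives of
  their almost-everywhere classes.
\<close>

abbreviation lebesgue01 :: "real measure"
  where "lebesgue01 \<equiv> lebesgue_on {0<..<1}"

definition L1 :: "(real \<Rightarrow> real) set"
  where "L1 = {f. integrable lebesgue01 f}"

definition L2 :: "(real \<Rightarrow> real) set"
  where "L2 = {f \<in> borel_measurable lebesgue01. integrable lebesgue01 (\<lambda>x. (f x)\<^sup>2)}"

definition Linf :: "(real \<Rightarrow> real) set"
  where "Linf = {f \<in> borel_measurable lebesgue01. \<exists>M. AE x in lebesgue01. \<bar>f x\<bar> \<le> M}"

text \<open>
  The test functions are those of class C1 with compact support in (0,1), as in Brezis,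
  Functional Analysis, Sobolev Spaces and Partial Differential Equations, Chapter 8. Smooth test
  functions yield the same weak derivatives and the same Sobolev spaces.
\<close>

definition test_functions :: "(real \<Rightarrow> real) set"
  where "test_functions =
    {\<phi>. \<phi> C1_differentiable_on UNIV \<and>
        (\<exists>K. compact K \<and> K \<subseteq> {0<..<1} \<and> (\<forall>x. x \<notin> K \<longrightarrow> \<phi> x = 0))}"

definition is_weak_deriv :: "(real \<Rightarrow> real) \<Rightarrow> (real \<Rightarrow> real) \<Rightarrow> bool"
  where "is_weak_deriv u g \<longleftrightarrow>
    (\<forall>\<phi>\<in>test_functions.
      (LINT x|lebesgue01. u x * deriv \<phi> x) = - (LINT x|lebesgue01. g x * \<phi> x))"

definition W11 :: "(real \<Rightarrow> real) set"
  where "W11 = {u \<in> L1. \<exists>g\<in>L1. is_weak_deriv u g}"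

definition W1inf :: "(real \<Rightarrow> real) set"
  where "W1inf = {u \<in> Linf. \<exists>g\<in>Linf. is_weak_deriv u g}"

text \<open>
  The weak derivative is determined only almost everywhere, so a representative is chosen. It is
  used only for functions in \<^const>\<open>W11\<close> (which contains \<^const>\<open>W1inf\<close>).
\<close>

definition wderiv :: "(real \<Rightarrow> real) \<Rightarrow> real \<Rightarrow> real"
  where "wderiv u = (SOME g. g \<in> L1 \<and> is_weak_deriv u g)"

text \<open>The closure of the test functions in the norm of \<^const>\<open>W11\<close>.\<close>

definition W11_0 :: "(real \<Rightarrow> real) set"
  where "W11_0 =
    {u \<in> W11. \<exists>\<phi>. (\<forall>n::nat. \<phi> n \<in> test_functions) \<and>
      (\<lambda>n. (LINT x|lebesgue01. \<bar>\<phi> n x - u x\<bar>)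
         + (LINT x|lebesgue01. \<bar>deriv (\<phi> n) x - wderiv u x\<bar>)) \<longlonglongrightarrow> 0}"

definition H1a :: "(real \<Rightarrow> real) \<Rightarrow> (real \<Rightarrow> real) set"
  where "H1a a = {u \<in> W11_0. (\<lambda>x. sqrt (a x) * wderiv u x) \<in> L2}"

definition H1ab :: "(real \<Rightarrow> real) \<Rightarrow> (real \<Rightarrow> real) \<Rightarrow> (real \<Rightarrow> real) set"
  where "H1ab a b = {u \<in> H1a a. (\<lambda>x. u x / sqrt (b x)) \<in> L2}"

text \<open>
  Pointwise conditions on the coefficients (which will be in \<^const>\<open>W11\<close>) refer to their continuous
  representatives on [0,1]; hence the continuity requirement.
\<close>

definition degenerate_at ::
    "(real \<Rightarrow> real) \<Rightarrow> (real \<Rightarrow> real) \<Rightarrow> real \<Rightarrow> real \<Rightarrow> real \<Rightarrow> bool"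
  where "degenerate_at a b x0 K1 K2 \<longleftrightarrow>
    continuous_on {0..1} a \<and> continuous_on {0..1} b \<and>
    x0 \<in> {0<..<1} \<and> a x0 = 0 \<and> b x0 = 0 \<and>
    (\<forall>x\<in>{0..1} - {x0}. a x > 0 \<and> b x > 0) \<and>
    (AE x in lebesgue_on {0..1}. (x - x0) * wderiv a x \<le> K1 * a x) \<and>
    (AE x in lebesgue_on {0..1}. (x - x0) * wderiv b x \<le> K2 * b x)"

definition WWD :: "(real \<Rightarrow> real) \<Rightarrow> (real \<Rightarrow> real) \<Rightarrow> real \<Rightarrow> real \<Rightarrow> real \<Rightarrow> bool"
  where "WWD a b x0 K1 K2 \<longleftrightarrow>
    degenerate_at a b x0 K1 K2 \<and> a \<in> W11 \<and> b \<in> W11 \<and> K1 \<in> {0<..<1} \<and> K2 \<in> {0<..<1}"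

definition WSD :: "(real \<Rightarrow> real) \<Rightarrow> (real \<Rightarrow> real) \<Rightarrow> real \<Rightarrow> real \<Rightarrow> real \<Rightarrow> bool"
  where "WSD a b x0 K1 K2 \<longleftrightarrow>
    degenerate_at a b x0 K1 K2 \<and> a \<in> W11 \<and> b \<in> W1inf \<and> K1 \<in> {0<..<1} \<and> K2 \<ge> 1"

definition SWD :: "(real \<Rightarrow> real) \<Rightarrow> (real \<Rightarrow> real) \<Rightarrow> real \<Rightarrow> real \<Rightarrow> real \<Rightarrow> bool"
  where "SWD a b x0 K1 K2 \<longleftrightarrow>
    degenerate_at a b x0 K1 K2 \<and> a \<in> W1inf \<and> b \<in> W11 \<and> K1 \<ge> 1 \<and> K2 \<in> {0<..<1}"

end

theory Submission
  imports Defs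
begin

text \<open>
  The inequalities \<open>(x - x0) a' \<le> K1 a\<close> and \<open>(x - x0) b' \<le> K2 b\<close> make
  \<open>a / \<bar>x - x0\<bar> powr K1\<close> and \<open>b / \<bar>x - x0\<bar> powr K2\<close> monotone on each side of
  \<open>x0\<close>, so \<open>a\<close> and \<open>b\<close> dominate multiples of these powers. It remains to
  prove the power-weight Hardy inequality bounding the integral of
  \<open>\<bar>x - x0\<bar> powr (\<alpha> - 2) * u\<^sup>2\<close> by that of
  \<open>\<bar>x - x0\<bar> powr \<alpha> * u'\<^sup>2\<close> for some \<open>\<alpha> \<noteq> 1\<close> with
  \<open>K1 \<le> \<alpha> \<le> 2 - K2\<close>. If \<open>K2 < 1\<close>, take \<open>\<alpha> = 2 - K2 > 1\<close> and
  represent \<open>u\<close> as the integral of \<open>u'\<close> from the end points, where \<open>u\<close> vanishes. If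
  \<open>K2 \<ge> 1\<close>, take \<open>\<alpha> = K1 < 1\<close> and integrate from \<open>x0\<close>: there \<open>u\<close> vanishes
  because \<open>b\<close> is Lipschitz, so that \<open>u\<^sup>2 / b\<close> would otherwise dominate a multiple of
  \<open>1 / \<bar>x - x0\<bar>\<close>. Both Hardy inequalities follow from the Schur test.
\<close>

section \<open>Hardy inequalities with power weights\<close>

lemma ennreal_two_mult_le_sum_squares: "2 * (x * y) \<le> x\<^sup>2 + (y::ennreal)\<^sup>2"
proof (cases x; cases y)
  fix r s assume rs: "0 \<le> r" "x = ennreal r" "0 \<le> s" "y = ennreal s"
  have "2 * (r * s) \<le> r\<^sup>2 + s\<^sup>2" using sum_squares_bound[of r s] by simp
  then have "ennreal (2 * (r * s)) \<le> ennreal (r\<^sup>2 + s\<^sup>2)" by (rule ennreal_leI)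
  then show ?thesis using rs by (simp add: ennreal_mult ennreal_power)
qed (auto simp: power2_eq_square)

lemma nn_integral_Cauchy_Schwarz:
  assumes [measurable]: "f \<in> borel_measurable M" "g \<in> borel_measurable M"
  shows "(\<integral>\<^sup>+x. f x * g x \<partial>M)\<^sup>2 \<le> (\<integral>\<^sup>+x. (f x)\<^sup>2 \<partial>M) * (\<integral>\<^sup>+x. (g x)\<^sup>2 \<partial>M)"
proof -
  let ?F = "\<integral>\<^sup>+x. (f x)\<^sup>2 \<partial>M" and ?G = "\<integral>\<^sup>+x. (g x)\<^sup>2 \<partial>M"
    and ?I = "\<integral>\<^sup>+x. f x * g x \<partial>M"
  \<comment> \<open>AM-GM applied to the products \<open>f x * g y\<close> and \<open>f y * g x\<close>, integrated over both variables.\<close>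
  have "2 * ?I\<^sup>2 = (\<integral>\<^sup>+x. (2 * ?I) * (f x * g x) \<partial>M)"
    by (simp add: nn_integral_cmult power2_eq_square mult.assoc)
  also have "\<dots> = (\<integral>\<^sup>+x. \<integral>\<^sup>+y. (2 * (f x * g x)) * (f y * g y) \<partial>M \<partial>M)"
    by (intro nn_integral_cong, subst nn_integral_cmult) (simp_all add: mult_ac)
  also have "\<dots> = (\<integral>\<^sup>+x. \<integral>\<^sup>+y. 2 * ((f x * g y) * (f y * g x)) \<partial>M \<partial>M)"
    by (intro nn_integral_cong) (simp add: mult_ac)
  also have "\<dots> \<le> (\<integral>\<^sup>+x. \<integral>\<^sup>+y. (f x * g y)\<^sup>2 + (f y * g x)\<^sup>2 \<partial>M \<partial>M)"
    by (intro nn_integral_mono ennreal_two_mult_le_sum_squares)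
  also have "\<dots> = (\<integral>\<^sup>+x. (f x)\<^sup>2 * ?G + ?F * (g x)\<^sup>2 \<partial>M)"
    by (simp add: power_mult_distrib nn_integral_add nn_integral_cmult nn_integral_multc)
  also have "\<dots> = 2 * (?F * ?G)"
    by (simp add: nn_integral_add nn_integral_cmult nn_integral_multc flip: mult_2)
  finally show ?thesis
    by (simp add: ennreal_mult_le_mult_iff)
qed

text \<open>Split \<open>G\<close> as \<open>h * (k * G)\<close>, where \<open>k\<close> is almost
  everywhere the reciprocal of \<open>h\<close>. Cauchy-Schwarz bounds the squared inner integral by
  \<open>p x\<close> times the integral of \<open>(k * G)\<close> squared over \<open>R x s\<close>.
  Tonelli then exchanges the integrals, and \<open>q\<close> controls what remains in
  \<open>x\<close>.\<close>

lemma nn_integral_Schur_test: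
  fixes R :: "'a \<Rightarrow> 'a \<Rightarrow> bool" and G v h k p q :: "'a \<Rightarrow> ennreal"
  assumes "sigma_finite_measure M"
    and [measurable]: "Measurable.pred (M \<Otimes>\<^sub>M M) (\<lambda>(x, s). R x s)"
    and [measurable]: "G \<in> borel_measurable M" "v \<in> borel_measurable M" "p \<in> borel_measurable M"
      "h \<in> borel_measurable M" "k \<in> borel_measurable M"
    and hk: "AE s in M. h s * k s = 1"
    and p: "AE x in M. (\<integral>\<^sup>+s. indicator {s. R x s} s * (h s)\<^sup>2 \<partial>M) \<le> p x"
    and q: "AE s in M. (\<integral>\<^sup>+x. indicator {x. R x s} x * (v x * p x) \<partial>M) \<le> q s"
  shows "(\<integral>\<^sup>+x. v x * (\<integral>\<^sup>+s. indicator {s. R x s} s * G s \<partial>M)\<^sup>2 \<partial>M)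
    \<le> (\<integral>\<^sup>+s. q s * ((k s)\<^sup>2 * (G s)\<^sup>2) \<partial>M)"
proof -
  interpret sigma_finite_measure M by fact
  interpret pair_sigma_finite M M ..
  have [measurable]: "(\<lambda>(x, s). indicator {s. R x s} s :: ennreal) \<in> borel_measurable (M \<Otimes>\<^sub>M M)"
    unfolding indicator_def by measurable
  \<comment> \<open>Idempotence of the indicator lets both Cauchy-Schwarz factors keep the
    restriction to \<open>R x s\<close>.\<close>
  have I2: "indicator A s * indicator A s = (indicator A s :: ennreal)" for A and s :: 'a
    by (auto simp: indicator_def)
  have pointwise: "v x * (\<integral>\<^sup>+s. indicator {s. R x s} s * G s \<partial>M)\<^sup>2
      \<le> (\<integral>\<^sup>+s. v x * p x * (indicator {s. R x s} s * ((k s)\<^sup>2 * (G s)\<^sup>2)) \<partial>M)"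
    if x: "x \<in> space M" "(\<integral>\<^sup>+s. indicator {s. R x s} s * (h s)\<^sup>2 \<partial>M) \<le> p x" for x
  proof -
    have [measurable]: "(\<lambda>s. indicator {s. R x s} s :: ennreal) \<in> borel_measurable M"
      using measurable_Pair2[OF \<open>(\<lambda>(x, s). indicator {s. R x s} s) \<in> borel_measurable (M \<Otimes>\<^sub>M M)\<close> x(1)]
      by simp
    let ?I = "\<lambda>s. indicator {s. R x s} s :: ennreal"
    have "(\<integral>\<^sup>+s. ?I s * G s \<partial>M) = (\<integral>\<^sup>+s. (?I s * h s) * (?I s * k s * G s) \<partial>M)"
      using hk
    proof (intro nn_integral_cong_AE, eventually_elim)
      fix s assume "h s * k s = 1"
      then have "(?I s * h s) * (?I s * k s * G s) = (?I s * ?I s) * (1 * G s)"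
        by (metis mult.assoc mult.left_commute)
      then show "?I s * G s = (?I s * h s) * (?I s * k s * G s)"
        by (simp only: I2 mult_1)
    qed
    also have "\<dots>\<^sup>2 \<le> (\<integral>\<^sup>+s. (?I s * h s)\<^sup>2 \<partial>M) * (\<integral>\<^sup>+s. (?I s * k s * G s)\<^sup>2 \<partial>M)"
      by (rule nn_integral_Cauchy_Schwarz) measurable
    also have "\<dots> = (\<integral>\<^sup>+s. ?I s * (h s)\<^sup>2 \<partial>M) * (\<integral>\<^sup>+s. ?I s * ((k s)\<^sup>2 * (G s)\<^sup>2) \<partial>M)"
      by (simp add: power_mult_distrib power2_eq_square[of "indicator _ _"] I2 mult_ac)
    also have "\<dots> \<le> p x * (\<integral>\<^sup>+s. ?I s * ((k s)\<^sup>2 * (G s)\<^sup>2) \<partial>M)"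
      by (intro mult_right_mono x) simp
    finally have "v x * (\<integral>\<^sup>+s. ?I s * G s \<partial>M)\<^sup>2
        \<le> v x * (p x * (\<integral>\<^sup>+s. ?I s * ((k s)\<^sup>2 * (G s)\<^sup>2) \<partial>M))"
      by (intro mult_left_mono) simp_all
    then show ?thesis by (simp add: nn_integral_cmult mult.assoc)
  qed
  have "(\<integral>\<^sup>+x. v x * (\<integral>\<^sup>+s. indicator {s. R x s} s * G s \<partial>M)\<^sup>2 \<partial>M)
      \<le> (\<integral>\<^sup>+x. \<integral>\<^sup>+s. v x * p x * (indicator {s. R x s} s * ((k s)\<^sup>2 * (G s)\<^sup>2)) \<partial>M \<partial>M)"
    using p AE_space by (intro nn_integral_mono_AE, eventually_elim) (rule pointwise)
  also have "\<dots> = (\<integral>\<^sup>+s. \<integral>\<^sup>+x. v x * p x * (indicator {s. R x s} s * ((k s)\<^sup>2 * (G s)\<^sup>2)) \<partial>M \<partial>M)"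
    by (rule Fubini'[symmetric]) measurable
  also have "\<dots> = (\<integral>\<^sup>+s. (\<integral>\<^sup>+x. indicator {x. R x s} x * (v x * p x) \<partial>M) * ((k s)\<^sup>2 * (G s)\<^sup>2) \<partial>M)"
  proof (intro nn_integral_cong)
    fix s assume s: "s \<in> space M"
    have [measurable]: "(\<lambda>x. indicator {x. R x s} x :: ennreal) \<in> borel_measurable M"
      using measurable_Pair1[OF \<open>(\<lambda>(x, s). indicator {s. R x s} s) \<in> borel_measurable (M \<Otimes>\<^sub>M M)\<close> s]
      by (simp add: indicator_def)
    have "(\<integral>\<^sup>+x. v x * p x * (indicator {s. R x s} s * ((k s)\<^sup>2 * (G s)\<^sup>2)) \<partial>M)
       = (\<integral>\<^sup>+x. (indicator {x. R x s} x * (v x * p x)) * ((k s)\<^sup>2 * (G s)\<^sup>2) \<partial>M)"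
      by (intro nn_integral_cong) (simp add: indicator_def mult_ac)
    then show "(\<integral>\<^sup>+x. v x * p x * (indicator {s. R x s} s * ((k s)\<^sup>2 * (G s)\<^sup>2)) \<partial>M)
       = (\<integral>\<^sup>+x. indicator {x. R x s} x * (v x * p x) \<partial>M) * ((k s)\<^sup>2 * (G s)\<^sup>2)"
      by (subst (asm) nn_integral_multc) auto
  qed
  also have "\<dots> \<le> (\<integral>\<^sup>+s. q s * ((k s)\<^sup>2 * (G s)\<^sup>2) \<partial>M)"
    using q by (intro nn_integral_mono_AE, eventually_elim) (intro mult_right_mono, simp_all)
  finally show ?thesis .
qed

text \<open>The symmetric form treats both sides of the centre \<open>c\<close> at once. The order
  of the last two arguments selects the direction of integration: for fixed \<open>x\<close>, the
  set of \<open>s\<close> with \<open>strictly_between c x s\<close> is the segment from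
  \<open>c\<close> to \<open>x\<close>, while \<open>strictly_between c s x\<close> describes the
  ray that starts at \<open>x\<close> and leads away from \<open>c\<close>.\<close>

definition strictly_between :: "real \<Rightarrow> real \<Rightarrow> real \<Rightarrow> bool"
  where "strictly_between c x s \<longleftrightarrow> c < s \<and> s < x \<or> x < s \<and> s < c"

lemma nn_integral_powr_between:
  assumes "e < 1" "x \<noteq> c"
  shows "(\<integral>\<^sup>+s. indicator {s. strictly_between c x s} s * ennreal (\<bar>s - c\<bar> powr (- e)) \<partial>lborel)
    \<le> ennreal (\<bar>x - c\<bar> powr (1 - e) / (1 - e))"
proof -
  have *: "(\<integral>\<^sup>+s. ennreal (indicator {0<..<t} s * \<bar>s\<bar> powr (- e)) \<partial>lborel) \<le> ennreal (t powr (1 - e) / (1 - e))"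
    if "0 < t" for t
  proof -
    have "((\<lambda>s. s powr (- e)) has_integral (t powr (- e + 1) / (- e + 1))) {0..t}"
      using assms that by (intro has_integral_powr_from_0) auto
    from nn_integral_has_integral_lebesgue[OF _ this]
    have "(\<integral>\<^sup>+s. ennreal (indicator {0..t} s * s powr (- e)) \<partial>lborel) = ennreal (t powr (1 - e) / (1 - e))"
      by (simp add: add.commute)
    moreover have "(\<integral>\<^sup>+s. ennreal (indicator {0<..<t} s * \<bar>s\<bar> powr (- e)) \<partial>lborel) 
        \<le> (\<integral>\<^sup>+s. ennreal (indicator {0..t} s * s powr (- e)) \<partial>lborel)"
      by (intro nn_integral_mono ennreal_leI) (auto simp: indicator_def)
    ultimately show ?thesis by simp
  qed
  \<comment> \<open>The substitution \<open>c + \<sigma> * s\<close> carries the side of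
    \<open>c\<close> containing \<open>x\<close> to the positive half-line, where \<open>*\<close>
    applies.\<close>
  define \<sigma> :: real where "\<sigma> = (if c < x then 1 else -1)"
  have \<sigma>: "\<sigma> \<noteq> 0" "\<bar>\<sigma>\<bar> = 1" by (auto simp: \<sigma>_def)
  have [measurable]: "Measurable.pred borel (strictly_between c x)" unfolding strictly_between_def by measurable
  have "(\<integral>\<^sup>+s. indicator {s. strictly_between c x s} s * ennreal (\<bar>s - c\<bar> powr (- e)) \<partial>lborel)
    = \<bar>\<sigma>\<bar> * (\<integral>\<^sup>+s. indicator {s. strictly_between c x s} (c + \<sigma> * s) * ennreal (\<bar>c + \<sigma> * s - c\<bar> powr (- e)) \<partial>lborel)"
    by (rule nn_integral_real_affine) (use \<sigma> in \<open>simp_all\<close>)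
  also have "\<dots> = (\<integral>\<^sup>+s. ennreal (indicator {0<..<\<bar>x - c\<bar>} s * \<bar>s\<bar> powr (- e)) \<partial>lborel)"
    using \<sigma>(2) assms(2)
    by (simp, intro nn_integral_cong)
       (auto simp: indicator_def abs_mult strictly_between_def \<sigma>_def split: if_splits)
  also have "\<dots> \<le> ennreal (\<bar>x - c\<bar> powr (1 - e) / (1 - e))"
    using * assms by simp
  finally show ?thesis .
qed

lemma nn_integral_powr_beyond:
  assumes "1 < e" "s \<noteq> c"
  shows "(\<integral>\<^sup>+x. indicator {x. strictly_between c x s} x * ennreal (\<bar>x - c\<bar> powr (- e)) \<partial>lborel)
    \<le> ennreal (\<bar>s - c\<bar> powr (1 - e) / (e - 1))"
proof -
  have *: "(\<integral>\<^sup>+s. ennreal (indicator {t<..} s * \<bar>s\<bar> powr (- e)) \<partial>lborel) \<le> ennreal (t powr (1 - e) / (e - 1))"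
    if "0 < t" for t
  proof -
    have "((\<lambda>s. s powr (- e)) has_integral (- (t powr (- e + 1)) / (- e + 1))) {t..}"
      using assms that by (intro has_integral_powr_to_inf) auto
    from nn_integral_has_integral_lebesgue[OF _ this]
    have "(\<integral>\<^sup>+s. ennreal (indicator {t..} s * s powr (- e)) \<partial>lborel) = ennreal (- (t powr (- e + 1)) / (- e + 1))"
      by simp
    also have "- (t powr (- e + 1)) / (- e + 1) = t powr (1 - e) / (e - 1)"
      using assms by (simp add: field_simps)
    finally have "(\<integral>\<^sup>+s. ennreal (indicator {t..} s * s powr (- e)) \<partial>lborel) = ennreal (t powr (1 - e) / (e - 1))" .
    moreover have "(\<integral>\<^sup>+s. ennreal (indicator {t<..} s * \<bar>s\<bar> powr (- e)) \<partial>lborel) 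
        \<le> (\<integral>\<^sup>+s. ennreal (indicator {t..} s * s powr (- e)) \<partial>lborel)"
      using that by (intro nn_integral_mono ennreal_leI) (auto simp: indicator_def)
    ultimately show ?thesis by simp
  qed
  \<comment> \<open>As before, the sign moves the side of \<open>c\<close> that contains
    \<open>s\<close> to the positive half-line.\<close>
  define \<sigma> :: real where "\<sigma> = (if c < s then 1 else -1)"
  have \<sigma>: "\<sigma> \<noteq> 0" "\<bar>\<sigma>\<bar> = 1" by (auto simp: \<sigma>_def)
  have [measurable]: "Measurable.pred borel (\<lambda>x. strictly_between c x s)" unfolding strictly_between_def by measurable
  have "(\<integral>\<^sup>+x. indicator {x. strictly_between c x s} x * ennreal (\<bar>x - c\<bar> powr (- e)) \<partial>lborel)
    = \<bar>\<sigma>\<bar> * (\<integral>\<^sup>+x. indicator {x. strictly_between c x s} (c + \<sigma> * x) * ennreal (\<bar>c + \<sigma> * x - c\<bar> powr (- e)) \<partial>lborel)"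
    by (rule nn_integral_real_affine) (use \<sigma> in \<open>simp_all\<close>)
  also have "\<dots> = (\<integral>\<^sup>+x. ennreal (indicator {\<bar>s - c\<bar><..} x * \<bar>x\<bar> powr (- e)) \<partial>lborel)"
    using \<sigma>(2) assms(2)
    by (simp, intro nn_integral_cong)
       (auto simp: indicator_def abs_mult strictly_between_def \<sigma>_def split: if_splits)
  also have "\<dots> \<le> ennreal (\<bar>s - c\<bar> powr (1 - e) / (e - 1))"
    using * assms by simp
  finally show ?thesis .
qed

lemma powr_half_squared: "((x::real) powr (e / 2))\<^sup>2 = x powr e"
  by (simp add: power2_eq_square flip: powr_add)

text \<open>This is the Schur test with the powers of exponent \<open>- \<beta> / 2\<close> and
  \<open>\<beta> / 2\<close> as \<open>h\<close> and \<open>k\<close>. The parameter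
  \<open>\<beta>\<close> is free and cancels: \<open>P\<close> yields \<open>p\<close>, the product
  of \<open>p\<close> with the weight of exponent \<open>\<alpha> - 2\<close> has exponent
  \<open>\<alpha> - 1 - \<beta>\<close> as in \<open>Q\<close>, and the resulting exponent
  \<open>\<alpha> - \<beta>\<close> is restored to \<open>\<alpha>\<close> by the square of
  \<open>k\<close>. Each of \<open>P\<close> and \<open>Q\<close> contributes one factor
  \<open>1 / m\<close>.\<close>

lemma Hardy_inequality_kernel:
  fixes \<alpha> \<beta> m c :: real and G :: "real \<Rightarrow> ennreal"
  assumes [measurable]: "Measurable.pred (lborel \<Otimes>\<^sub>M lborel) (\<lambda>(x, s). R x s)"
    and [measurable]: "G \<in> borel_measurable borel"
    and m: "m > 0"
    and P: "\<And>x. x \<noteq> c \<Longrightarrow> (\<integral>\<^sup>+s. indicator {s. R x s} s * ennreal (\<bar>s - c\<bar> powr (- \<beta>)) \<partial>lborel)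
      \<le> ennreal (\<bar>x - c\<bar> powr (1 - \<beta>) / m)"
    and Q: "\<And>s. s \<noteq> c \<Longrightarrow> (\<integral>\<^sup>+x. indicator {x. R x s} x * ennreal (\<bar>x - c\<bar> powr (\<alpha> - 1 - \<beta>)) \<partial>lborel)
      \<le> ennreal (\<bar>s - c\<bar> powr (\<alpha> - \<beta>) / m)"
  shows "(\<integral>\<^sup>+x. ennreal (\<bar>x - c\<bar> powr (\<alpha> - 2)) * (\<integral>\<^sup>+s. indicator {s. R x s} s * G s \<partial>lborel)\<^sup>2 \<partial>lborel)
    \<le> ennreal (1 / m\<^sup>2) * (\<integral>\<^sup>+s. ennreal (\<bar>s - c\<bar> powr \<alpha>) * (G s)\<^sup>2 \<partial>lborel)"
proof -
  let ?h = "\<lambda>s. ennreal (\<bar>s - c\<bar> powr (- \<beta> / 2))" and ?k = "\<lambda>s. ennreal (\<bar>s - c\<bar> powr (\<beta> / 2))"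
    and ?v = "\<lambda>x. ennreal (\<bar>x - c\<bar> powr (\<alpha> - 2))" and ?p = "\<lambda>x. ennreal (\<bar>x - c\<bar> powr (1 - \<beta>) / m)"
    and ?q = "\<lambda>s. ennreal (\<bar>s - c\<bar> powr (\<alpha> - \<beta>) / m\<^sup>2)"
  have ne: "AE x in lborel. x \<noteq> c" by (rule AE_lborel_singleton)
  have "(\<integral>\<^sup>+x. ?v x * (\<integral>\<^sup>+s. indicator {s. R x s} s * G s \<partial>lborel)\<^sup>2 \<partial>lborel)
    \<le> (\<integral>\<^sup>+s. ?q s * ((?k s)\<^sup>2 * (G s)\<^sup>2) \<partial>lborel)"
  proof (rule nn_integral_Schur_test[where p = ?p and h = ?h])
    show "sigma_finite_measure (lborel :: real measure)" by unfold_locales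
    show "AE s in lborel. ?h s * ?k s = 1"
      using ne by eventually_elim (simp flip: ennreal_mult powr_add)
    show "AE x in lborel. (\<integral>\<^sup>+s. indicator {s. R x s} s * (?h s)\<^sup>2 \<partial>lborel) \<le> ?p x"
      using ne by eventually_elim (simp only: ennreal_power powr_ge_zero powr_half_squared, rule P)
    show "AE s in lborel. (\<integral>\<^sup>+x. indicator {x. R x s} x * (?v x * ?p x) \<partial>lborel) \<le> ?q s"
      using ne
    proof eventually_elim
      fix s assume s: "s \<noteq> c"
      have [measurable]: "Measurable.pred lborel (\<lambda>x. R x s)"
        using measurable_Pair1[OF assms(1), of s] by simp
      have "\<bar>x - c\<bar> powr (\<alpha> - 2) * (\<bar>x - c\<bar> powr (1 - \<beta>) / m) = \<bar>x - c\<bar> powr (\<alpha> - 1 - \<beta>) / m" for x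
      proof -
        have "\<bar>x - c\<bar> powr (\<alpha> - 2) * \<bar>x - c\<bar> powr (1 - \<beta>) = \<bar>x - c\<bar> powr (\<alpha> - 1 - \<beta>)"
          by (subst powr_add[symmetric]) (simp add: algebra_simps)
        then show ?thesis by simp
      qed
      then have "?v x * ?p x = ennreal (1 / m) * ennreal (\<bar>x - c\<bar> powr (\<alpha> - 1 - \<beta>))" for x
        using m by (simp flip: ennreal_mult)
      then have "(\<integral>\<^sup>+x. indicator {x. R x s} x * (?v x * ?p x) \<partial>lborel)
        = ennreal (1 / m) * (\<integral>\<^sup>+x. indicator {x. R x s} x * ennreal (\<bar>x - c\<bar> powr (\<alpha> - 1 - \<beta>)) \<partial>lborel)"
        by (subst nn_integral_cmult[symmetric]) (auto simp: mult_ac)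
      also have "\<dots> \<le> ennreal (1 / m) * ennreal (\<bar>s - c\<bar> powr (\<alpha> - \<beta>) / m)"
        by (intro mult_left_mono Q s) simp
      also have "\<dots> = ?q s"
        using m by (simp add: power2_eq_square flip: ennreal_mult)
      finally show "(\<integral>\<^sup>+x. indicator {x. R x s} x * (?v x * ?p x) \<partial>lborel) \<le> ?q s" .
    qed
  qed measurable
  also have "\<dots> = (\<integral>\<^sup>+s. ennreal (1 / m\<^sup>2) * (ennreal (\<bar>s - c\<bar> powr \<alpha>) * (G s)\<^sup>2) \<partial>lborel)"
  proof (intro nn_integral_cong)
    fix s
    have "\<bar>s - c\<bar> powr (\<alpha> - \<beta>) / m\<^sup>2 * (\<bar>s - c\<bar> powr (\<beta> / 2))\<^sup>2 = 1 / m\<^sup>2 * \<bar>s - c\<bar> powr \<alpha>"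
      by (simp add: powr_half_squared flip: powr_add)
    then have "?q s * (?k s)\<^sup>2 = ennreal (1 / m\<^sup>2) * ennreal (\<bar>s - c\<bar> powr \<alpha>)"
      by (simp add: ennreal_power flip: ennreal_mult)
    then show "?q s * ((?k s)\<^sup>2 * (G s)\<^sup>2) = ennreal (1 / m\<^sup>2) * (ennreal (\<bar>s - c\<bar> powr \<alpha>) * (G s)\<^sup>2)"
      by (simp only: mult.assoc[symmetric])
  qed
  also have "\<dots> = ennreal (1 / m\<^sup>2) * (\<integral>\<^sup>+s. ennreal (\<bar>s - c\<bar> powr \<alpha>) * (G s)\<^sup>2 \<partial>lborel)"
    by (rule nn_integral_cmult) measurable
  finally show ?thesis .
qed

lemma Hardy_inequality_near:
  fixes \<alpha> c :: real and G :: "real \<Rightarrow> ennreal"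
  assumes "\<alpha> < 1" and [measurable]: "G \<in> borel_measurable borel"
  shows "(\<integral>\<^sup>+x. ennreal (\<bar>x - c\<bar> powr (\<alpha> - 2)) * (\<integral>\<^sup>+s. indicator {s. strictly_between c x s} s * G s \<partial>lborel)\<^sup>2 \<partial>lborel)
    \<le> ennreal (4 / (1 - \<alpha>)\<^sup>2) * (\<integral>\<^sup>+s. ennreal (\<bar>s - c\<bar> powr \<alpha>) * (G s)\<^sup>2 \<partial>lborel)"
proof -
  \<comment> \<open>Any \<open>\<beta>\<close> strictly between \<open>\<alpha>\<close> and 1 works; the midpoint gives the sharp constant.\<close>
  define \<beta> m where "\<beta> = (1 + \<alpha>) / 2" and "m = (1 - \<alpha>) / 2"
  \<comment> \<open>Integrability at \<open>c\<close> needs \<open>\<beta> < 1\<close>, and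
    integrability at infinity needs \<open>1 + \<beta> - \<alpha> > 1\<close>, that is
    \<open>\<alpha> < \<beta>\<close>. The equations match the exponents with those in
    \<open>Hardy_inequality_kernel\<close>.\<close>
  have m: "1 + \<beta> - \<alpha> - 1 = m" "m > 0" "1 - (1 + \<beta> - \<alpha>) = \<alpha> - \<beta>"
    "- (1 + \<beta> - \<alpha>) = \<alpha> - 1 - \<beta>" "\<beta> < 1" "1 < 1 + \<beta> - \<alpha>"
    and m': "1 - \<beta> = m"
    using assms(1) by (auto simp: \<beta>_def m_def field_simps)
  have "4 / (1 - \<alpha>)\<^sup>2 = 1 / m\<^sup>2" by (simp add: m_def power_divide)
  moreover have "Measurable.pred (lborel \<Otimes>\<^sub>M lborel) (\<lambda>(x, s). strictly_between c x s)"
    unfolding strictly_between_def by measurable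
  ultimately show ?thesis
    using Hardy_inequality_kernel[of "strictly_between c" G m c \<beta> \<alpha>]
      nn_integral_powr_between[of \<beta> _ c] nn_integral_powr_beyond[of "1 + \<beta> - \<alpha>" _ c, unfolded m]
      m \<open>G \<in> borel_measurable borel\<close>
    by (simp add: m')
qed

lemma Hardy_inequality_far:
  fixes \<alpha> c :: real and G :: "real \<Rightarrow> ennreal"
  assumes "1 < \<alpha>" and [measurable]: "G \<in> borel_measurable borel"
  shows "(\<integral>\<^sup>+x. ennreal (\<bar>x - c\<bar> powr (\<alpha> - 2)) * (\<integral>\<^sup>+s. indicator {s. strictly_between c s x} s * G s \<partial>lborel)\<^sup>2 \<partial>lborel)
    \<le> ennreal (4 / (1 - \<alpha>)\<^sup>2) * (\<integral>\<^sup>+s. ennreal (\<bar>s - c\<bar> powr \<alpha>) * (G s)\<^sup>2 \<partial>lborel)"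
proof -
  \<comment> \<open>Again the midpoint, now with \<open>1 < \<beta> < \<alpha>\<close>. The two
    power integrals exchange their roles: the integral in \<open>s\<close> runs towards infinity and
    the one in \<open>x\<close> starts at \<open>c\<close>.\<close>
  define \<beta> m where "\<beta> = (1 + \<alpha>) / 2" and "m = (\<alpha> - 1) / 2"
  have m: "\<beta> - 1 = m" "1 - (1 + \<beta> - \<alpha>) = m" "m > 0" 
    "- (1 + \<beta> - \<alpha>) = \<alpha> - 1 - \<beta>" "1 < \<beta>" "1 + \<beta> - \<alpha> < 1"
    using assms(1) by (auto simp: \<beta>_def m_def field_simps)
  have "4 / (1 - \<alpha>)\<^sup>2 = 1 / m\<^sup>2" by (simp add: m_def power_divide power2_commute[of 1])
  moreover have "Measurable.pred (lborel \<Otimes>\<^sub>M lborel) (\<lambda>(x, s). strictly_between c s x)"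
    unfolding strictly_between_def by measurable
  ultimately show ?thesis
    using Hardy_inequality_kernel[of "\<lambda>x s. strictly_between c s x" G m c \<beta> \<alpha>]
      nn_integral_powr_beyond[of \<beta> _ c] nn_integral_powr_between[of "1 + \<beta> - \<alpha>" _ c, unfolded m]
      m \<open>G \<in> borel_measurable borel\<close>
    by simp
qed

section \<open>Sobolev functions on the unit interval\<close>

lemma test_functionD:
  assumes "\<phi> \<in> test_functions"
  shows "(\<phi> has_real_derivative deriv \<phi> x) (at x)" "continuous_on UNIV (deriv \<phi>)"
    "x \<notin> {0<..<1} \<Longrightarrow> \<phi> x = 0"
proof -
  from assms obtain D where D: "\<And>x. (\<phi> has_vector_derivative D x) (at x)" "continuous_on UNIV D"
    by (auto simp: test_functions_def C1_differentiable_on_def)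
  then have "deriv \<phi> = D"
    by (intro ext DERIV_imp_deriv) (simp add: has_real_derivative_iff_has_vector_derivative)
  with D show "(\<phi> has_real_derivative deriv \<phi> x) (at x)" "continuous_on UNIV (deriv \<phi>)"
    by (simp_all add: has_real_derivative_iff_has_vector_derivative)
  show "x \<notin> {0<..<1} \<Longrightarrow> \<phi> x = 0"
    using assms by (auto simp: test_functions_def)
qed

lemma integrable_lebesgue_on_subset:
  fixes f :: "real \<Rightarrow> real"
  assumes "integrable (lebesgue_on S) f" "T \<subseteq> S" "S \<in> sets lebesgue" "T \<in> sets lebesgue"
  shows "integrable (lebesgue_on T) f"
  using assms set_integrable_subset[of lebesgue S f T]
  by (simp add: integrable_restrict_space set_integrable_def)

lemma continuous_in_L1: "continuous_on {0..1} f \<Longrightarrow> f \<in> L1"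
  unfolding L1_def mem_Collect_eq
  by (rule integrable_lebesgue_on_subset[OF continuous_imp_integrable_real]) auto

lemma L1_integrable_on:
  assumes "g \<in> L1" "0 \<le> x" "y \<le> 1"
  shows "integrable (lebesgue_on {x<..<y}) g" "g integrable_on {x..y}"
    "integral {x..y} g = integral\<^sup>L (lebesgue_on {x<..<y}) g"
proof -
  show *: "integrable (lebesgue_on {x<..<y}) g"
    by (rule integrable_lebesgue_on_subset[of "{0<..<1}"]) (use assms in \<open>auto simp: L1_def\<close>)
  then show "g integrable_on {x..y}"
    by (metis has_integral_integral_lebesgue_on integrable_on_def integrable_on_open_interval_real
        lmeasurable_interval(2) fmeasurableD box_real(1))
  show "integral {x..y} g = integral\<^sup>L (lebesgue_on {x<..<y}) g"
    using lebesgue_integral_eq_integral[OF *] by (simp add: integral_open_interval_real)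
qed

lemma L1_integral_bound:
  assumes "g \<in> L1" "0 \<le> x" "y \<le> 1"
  shows "ennreal \<bar>integral {x..y} g\<bar> \<le> (\<integral>\<^sup>+s. indicator {x<..<y} s * ennreal \<bar>g s\<bar> \<partial>lebesgue)"
  using integral_norm_bound_ennreal[OF L1_integrable_on(1)[OF assms]]
  by (simp add: L1_integrable_on(3)[OF assms] nn_integral_restrict_space mult.commute)

lemma L1_integral_bound_L1_norm:
  assumes "g \<in> L1" "0 \<le> x" "y \<le> 1"
  shows "\<bar>integral {x..y} g\<bar> \<le> (LINT x|lebesgue01. \<bar>g x\<bar>)"
proof -
  have "ennreal \<bar>integral {x..y} g\<bar> \<le> (\<integral>\<^sup>+s. ennreal \<bar>g s\<bar> * indicator {0<..<1} s \<partial>lebesgue)"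
    by (rule order.trans[OF L1_integral_bound[OF assms]], rule nn_integral_mono)
       (use assms in \<open>auto simp: indicator_def\<close>)
  also have "\<dots> = (\<integral>\<^sup>+s. ennreal \<bar>g s\<bar> \<partial>lebesgue01)"
    by (simp add: nn_integral_restrict_space)
  also have "\<dots> = ennreal (LINT x|lebesgue01. \<bar>g x\<bar>)"
    using assms by (intro nn_integral_eq_integral) (auto simp: L1_def)
  finally show ?thesis by (simp add: ennreal_le_iff)
qed

lemma wderiv_W11:
  assumes "u \<in> W11"
  shows "wderiv u \<in> L1" "is_weak_deriv u (wderiv u)"
  using assms someI_ex[of "\<lambda>g. g \<in> L1 \<and> is_weak_deriv u g"]
  by (auto simp: W11_def wderiv_def)

text \<open>
  The approximating test functions are the primitives of their derivatives, hence converge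
  uniformly to the primitive of the weak derivative, both at the right end point and in L1.
\<close>

lemma W11_0_primitive:
  assumes "u \<in> W11_0"
  shows "AE x in lebesgue01. u x = integral {0..x} (wderiv u)" "integral {0..1} (wderiv u) = 0"
proof -
  let ?g = "wderiv u"
  define U where "U = (\<lambda>x. integral {0..x} ?g)"
  from assms obtain \<phi> :: "nat \<Rightarrow> real \<Rightarrow> real" where \<phi>: "\<And>n. \<phi> n \<in> test_functions"
    and lim: "(\<lambda>n. (LINT x|lebesgue01. \<bar>\<phi> n x - u x\<bar>) + (LINT x|lebesgue01. \<bar>deriv (\<phi> n) x - ?g x\<bar>)) \<longlonglongrightarrow> 0"
    and u: "u \<in> W11"
    by (auto simp: W11_0_def)
  define e where "e = (\<lambda>n. (LINT x|lebesgue01. \<bar>\<phi> n x - u x\<bar>) + (LINT x|lebesgue01. \<bar>deriv (\<phi> n) x - ?g x\<bar>))"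
  have e: "e \<longlonglongrightarrow> 0" using lim by (simp add: e_def)
  have g: "?g \<in> L1" using wderiv_W11 u by blast
  have u1: "u \<in> L1" using u by (simp add: W11_def)
  have d1: "deriv (\<phi> n) \<in> L1" for n
    using test_functionD(2)[OF \<phi>] by (intro continuous_in_L1) (blast intro: continuous_on_subset)
  have \<phi>1: "\<phi> n \<in> L1" for n
    by (intro continuous_in_L1 continuous_at_imp_continuous_on ballI DERIV_isCont[OF test_functionD(1)] \<phi>)
  have contU: "continuous_on {0..1} U"
    unfolding U_def using g by (intro indefinite_integral_continuous_1 L1_integrable_on) auto
  then have U1: "U \<in> L1" by (rule continuous_in_L1)
  have bound: "\<bar>\<phi> n x - U x\<bar> \<le> e n" if x: "x \<in> {0..1}" for n x
  proof -
    have "(deriv (\<phi> n) has_integral (\<phi> n x - \<phi> n 0)) {0..x}"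
      using x test_functionD(1)[OF \<phi>, of n]
      by (intro fundamental_theorem_of_calculus)
        (simp_all add: has_vector_derivative_at_within has_real_derivative_iff_has_vector_derivative)
    then have "((\<lambda>y. deriv (\<phi> n) y - ?g y) has_integral (\<phi> n x - \<phi> n 0 - U x)) {0..x}"
      unfolding U_def using x g
      by (intro has_integral_diff integrable_integral L1_integrable_on) auto
    then have "\<phi> n x - U x = integral {0..x} (\<lambda>y. deriv (\<phi> n) y - ?g y)"
      using test_functionD(3)[OF \<phi>, of 0] by (simp add: integral_unique)
    also have "\<bar>\<dots>\<bar> \<le> (LINT x|lebesgue01. \<bar>deriv (\<phi> n) x - ?g x\<bar>)"
      using x d1 g by (intro L1_integral_bound_L1_norm) (auto simp: L1_def)
    also have "\<dots> \<le> e n" by (simp add: e_def)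
    finally show ?thesis .
  qed
  have "(\<lambda>n. \<bar>\<phi> n 1 - U 1\<bar>) \<longlonglongrightarrow> 0"
    by (rule tendsto_sandwich[OF _ _ tendsto_const e]) (use bound[of 1] in auto)
  then have "U 1 = 0"
    using test_functionD(3)[OF \<phi>, of 1] by (simp add: LIMSEQ_const_iff)
  then show "integral {0..1} ?g = 0" by (simp add: U_def)
  \<comment> \<open>Insert \<open>\<phi> n\<close> between \<open>u\<close> and \<open>U\<close>.
    The uniform bound \<open>e n\<close> integrates to \<open>e n\<close> because the interval has
    length one.\<close>
  have "(LINT x|lebesgue01. \<bar>u x - U x\<bar>) \<le> e n + e n" for n
  proof -
    have int: "integrable lebesgue01 (\<lambda>x. \<bar>\<phi> n x - u x\<bar>)" "integrable lebesgue01 (\<lambda>x. \<bar>u x - U x\<bar>)"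
      using u1 U1 \<phi>1[of n] by (simp_all add: L1_def)
    have const: "integrable lebesgue01 (\<lambda>x. e n)"
      by (intro finite_measure.integrable_const finite_measure_lebesgue_on) simp
    have "(LINT x|lebesgue01. \<bar>u x - U x\<bar>) \<le> (LINT x|lebesgue01. \<bar>\<phi> n x - u x\<bar> + e n)"
    proof (rule integral_mono)
      fix x assume "x \<in> space lebesgue01"
      then show "\<bar>u x - U x\<bar> \<le> \<bar>\<phi> n x - u x\<bar> + e n"
        using bound[of x n] by simp
    qed (intro int const Bochner_Integration.integrable_add)+
    also have "\<dots> = (LINT x|lebesgue01. \<bar>\<phi> n x - u x\<bar>) + e n"
      using Bochner_Integration.integral_add[OF int(1) const] by (simp add: measure_restrict_space)
    also have "\<dots> \<le> e n + e n" by (simp add: e_def)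
    finally show ?thesis .
  qed
  then have "(LINT x|lebesgue01. \<bar>u x - U x\<bar>) \<le> 0"
    by (intro LIMSEQ_le_const[of "\<lambda>n. e n + e n"]) (use tendsto_add[OF e e] in auto)
  then have "(LINT x|lebesgue01. \<bar>u x - U x\<bar>) = 0" by (simp add: order_antisym)
  then show "AE x in lebesgue01. u x = integral {0..x} ?g"
    using u1 U1 by (subst (asm) integral_nonneg_eq_0_iff_AE) (auto simp: L1_def U_def)
qed

section \<open>Monotonicity from the sign of a weak derivative\<close>

lemma L1_mult_continuous:
  assumes "f \<in> L1" "continuous_on {0..1} c"
  shows "(\<lambda>x. f x * c x) \<in> L1"
proof -
  from assms(2) have "bounded (c ` {0..1})"
    by (intro compact_imp_bounded compact_continuous_image) auto
  then obtain B where "\<forall>x\<in>{0..1}. \<bar>c x\<bar> \<le> B" by (auto simp: bounded_iff)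
  then have B: "\<bar>c x\<bar> \<le> B" if "x \<in> {0..1}" for x using that by blast
  have c: "c \<in> borel_measurable lebesgue01"
    using continuous_in_L1[OF assms(2)] by (simp add: L1_def)
  have f: "integrable lebesgue01 f" using assms(1) by (simp add: L1_def)
  have "integrable lebesgue01 (\<lambda>x. f x * c x)"
  proof (rule Bochner_Integration.integrable_bound)
    show "integrable lebesgue01 (\<lambda>x. B * \<bar>f x\<bar>)" using f by simp
    show "(\<lambda>x. f x * c x) \<in> borel_measurable lebesgue01"
      using f c by (intro borel_measurable_times) auto
    have "\<bar>f x\<bar> * \<bar>c x\<bar> \<le> B * \<bar>f x\<bar>" if "x \<in> {0<..<1}" for x
      using mult_right_mono[OF B[of x], of "\<bar>f x\<bar>"] that by (simp add: mult.commute)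
    then show "AE x in lebesgue01. norm (f x * c x) \<le> norm (B * \<bar>f x\<bar>)"
      using B[of 0] by (intro AE_I2) (auto simp: abs_mult)
  qed
  then show ?thesis by (simp add: L1_def)
qed

text \<open>The difference of two translates of \<open>\<psi>\<close> serves as a C1 cutoff
  approximating the indicator of an interval. The derivative \<open>k\<close> is nonnegative with
  unit mass on \<open>[0,h]\<close>, so integrating against its translates averages a function just
  to the right of a point.\<close>

lemma C1_step_function:
  fixes h :: real
  assumes "h > 0"
  obtains \<psi> k :: "real \<Rightarrow> real"
  where "\<And>x. (\<psi> has_real_derivative k x) (at x)" "continuous_on UNIV k" "\<And>x. 0 \<le> k x"
    "\<And>x. x \<le> 0 \<Longrightarrow> \<psi> x = 0" "\<And>x. x \<le> 0 \<Longrightarrow> k x = 0"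
    "\<And>x. h \<le> x \<Longrightarrow> \<psi> x = 1" "\<And>x. h \<le> x \<Longrightarrow> k x = 0"
proof
  \<comment> \<open>\<open>?P x\<close> is the square of the positive part of \<open>x\<close>, and \<open>?k\<close> is a hat function on [0,1].\<close>
  let ?P = "\<lambda>x::real. (x * \<bar>x\<bar> + x\<^sup>2) / 2"
  let ?\<psi> = "\<lambda>t. 2 * (?P t - 2 * ?P (t - 1/2) + ?P (t - 1))"
  let ?k = "\<lambda>t::real. 2 * ((\<bar>t\<bar> + t) - 2 * (\<bar>t - 1/2\<bar> + (t - 1/2)) + (\<bar>t - 1\<bar> + (t - 1)))"
  \<comment> \<open>At 0 the difference quotient is the absolute value of the increment, so it tends
    to 0. Elsewhere the function agrees locally with plus or minus the square.\<close>
  have abs: "((\<lambda>x. x * \<bar>x\<bar>) has_real_derivative 2 * \<bar>x\<bar>) (at x)" for x :: real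
  proof (cases "x = 0")
    case True
    have "(\<lambda>h. \<bar>h\<bar>) \<midarrow>0\<rightarrow> (0::real)" using tendsto_rabs[OF tendsto_ident_at[of 0 UNIV]] by simp
    then show ?thesis using True
      by (auto simp: DERIV_def elim!: Lim_transform_eventually intro: eventually_at_filter[THEN iffD2] always_eventually)
  next
    case False
    have "((\<lambda>y. sgn x * y\<^sup>2) has_real_derivative 2 * \<bar>x\<bar>) (at x)"
      by (auto intro!: derivative_eq_intros simp: abs_sgn)
    then show ?thesis
      by (rule has_field_derivative_transform_within_open[of _ _ _ "if 0 < x then {0<..} else {..<0}"])
        (use False in \<open>auto simp: sgn_if power2_eq_square split: if_splits\<close>)
  qed
  have P: "(?P has_real_derivative \<bar>x\<bar> + x) (at x)" for x
    using DERIV_cdivide[OF DERIV_add[OF abs DERIV_power[OF DERIV_ident, of 2]], of 2 x]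
    by (simp add: add_divide_distrib)
  have Ps: "((\<lambda>x. ?P (x - c)) has_real_derivative (\<bar>x - c\<bar> + (x - c))) (at x)" for x c
    using DERIV_chain2[of ?P "\<bar>x - c\<bar> + (x - c)" "\<lambda>x. x - c" x 1 UNIV] P[of "x - c"]
    by (simp add: DERIV_const DERIV_diff[OF DERIV_ident DERIV_const, simplified])
  have \<psi>: "(?\<psi> has_real_derivative ?k t) (at t)" for t
    by (rule DERIV_cmult DERIV_add DERIV_diff P Ps)+
  show "((\<lambda>x. ?\<psi> (x / h)) has_real_derivative ?k (x / h) / h) (at x)" for x
    using DERIV_chain2[of ?\<psi> "?k (x / h)" "\<lambda>x. x / h" x "1 / h" UNIV] \<psi>[of "x / h"]
      DERIV_cdivide[OF DERIV_ident, of h x UNIV]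
    by simp
  show "continuous_on UNIV (\<lambda>x. ?k (x / h) / h)"
    using assms by (intro continuous_intros) auto
  have k: "0 \<le> ?k t" for t by (simp add: abs_if)
  then show "0 \<le> ?k (x / h) / h" for x using assms by (rule divide_nonneg_pos)
  have neg: "?\<psi> t = 0" "?k t = 0" if "t \<le> 0" for t
    using that by (simp_all add: abs_if power2_eq_square algebra_simps)
  show "?\<psi> (x / h) = 0" if "x \<le> 0" for x
    by (rule neg) (use that assms in \<open>simp add: divide_nonpos_pos\<close>)
  show "?k (x / h) / h = 0" if "x \<le> 0" for x
    by (subst neg) (use that assms in \<open>simp_all add: divide_nonpos_pos\<close>)
  have pos: "?\<psi> t = 1" "?k t = 0" if "1 \<le> t" for t
    using that by (simp_all add: abs_if power2_eq_square field_simps)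
  show "?\<psi> (x / h) = 1" if "h \<le> x" for x
    by (rule pos) (use that assms in simp)
  show "?k (x / h) / h = 0" if "h \<le> x" for x
    by (subst pos) (use that assms in simp_all)
qed

text \<open>The weights used below may be singular at an end point of \<open>{l<..<r}\<close>, but
  the cutoff vanishes near both end points. The extension is therefore continuous on two open sets
  that cover the line.\<close>

lemma continuous_on_extend_zero:
  fixes f :: "real \<Rightarrow> real"
  assumes "continuous_on {l<..<r} f" "l < p" "q < r" "\<And>x. x \<notin> {p..q} \<Longrightarrow> f x = 0"
  shows "continuous_on UNIV (\<lambda>x. if x \<in> {l<..<r} then f x else 0)"
proof -
  have "{l<..<r} \<union> - {p..q} = UNIV" using assms by auto
  moreover have "continuous_on ({l<..<r} \<union> - {p..q}) (\<lambda>x. if x \<in> {l<..<r} then f x else 0)"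
  proof (rule continuous_on_open_Un)
    show "continuous_on {l<..<r} (\<lambda>x. if x \<in> {l<..<r} then f x else 0)"
      using assms(1) by (rule continuous_on_eq) simp
    show "continuous_on (- {p..q}) (\<lambda>x. if x \<in> {l<..<r} then f x else 0)"
      by (rule continuous_on_eq[OF continuous_on_const[of _ 0]]) (use assms(4) in auto)
  qed auto
  ultimately show ?thesis by simp
qed

text \<open>
  The weight is absorbed into the test function: the weak derivative is tested against
  \<open>\<phi> * w\<close>, where \<open>\<phi>\<close> is a C1 approximation of the indicator of \<open>[p,q]\<close>. No product
  rule for weak derivatives is needed.
\<close>

lemma weak_deriv_nonneg_imp_mono:
  fixes u g w w' :: "real \<Rightarrow> real"
  assumes u: "u \<in> L1" and g: "g \<in> L1" and weak: "is_weak_deriv u g"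
    and lr: "0 \<le> l" "r \<le> 1"
    and cont: "continuous_on {l<..<r} u"
    and w: "\<And>x. x \<in> {l<..<r} \<Longrightarrow> (w has_real_derivative w' x) (at x)"
    and w': "continuous_on {l<..<r} w'"
    and sign: "AE x in lebesgue01. x \<in> {l<..<r} \<longrightarrow> 0 \<le> g x * w x + u x * w' x"
    and pq: "l < p" "p < q" "q < r"
  shows "u p * w p \<le> u q * w q"
proof (rule ccontr)
  assume "\<not> ?thesis"
  define f where "f = (\<lambda>x. u x * w x)"
  have contw: "continuous_on {l<..<r} w"
    by (intro continuous_at_imp_continuous_on ballI DERIV_isCont[OF w])
  have contf: "continuous_on {l<..<r} f"
    unfolding f_def by (intro continuous_intros cont contw)
  from \<open>\<not> ?thesis\<close> have "f q < f p" by (simp add: f_def)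
  \<comment> \<open>If monotonicity fails, two distinct levels separate \<open>f q\<close> from
    \<open>f p\<close>. Their gap will contradict the sign condition.\<close>
  then obtain m2 where m2: "f q < m2" "m2 < f p" using dense by blast
  then obtain m1 where m1: "m2 < m1" "m1 < f p" using dense by blast
  have isc: "isCont f x" if "x \<in> {l<..<r}" for x
    using contf that by (simp add: continuous_on_eq_continuous_at)
  have "\<forall>\<^sub>F x in nhds p. m1 < f x" "\<forall>\<^sub>F x in nhds q. f x < m2"
    using isc[of p] isc[of q] pq m1 m2
    by (auto intro!: order_tendstoD simp: isCont_def tendsto_at_iff_tendsto_nhds)
  then obtain h1 h2 where h1: "h1 > 0" "\<And>x. dist x p < h1 \<Longrightarrow> m1 < f x"
    and h2: "h2 > 0" "\<And>x. dist x q < h2 \<Longrightarrow> f x < m2"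
    unfolding eventually_nhds_metric by blast
  \<comment> \<open>Halving gives strict inequalities: \<open>f\<close> exceeds \<open>m1\<close> on
    \<open>[p, p + h]\<close>, stays below \<open>m2\<close> on \<open>[q, q + h]\<close>, and the
    support of the cutoff ends before \<open>r\<close>.\<close>
  define h where "h = Min {h1, h2, r - q} / 2"
  have h': "2 * h \<le> h1" "2 * h \<le> h2" "2 * h \<le> r - q" "h > 0"
    using h1(1) h2(1) pq by (simp_all add: h_def)
  have h: "h > 0" "h < h1" "h < h2" "q + h < r"
    using h1(1) h2(1) pq h' by linarith+
  obtain \<psi> k where \<psi>: "\<And>x. (\<psi> has_real_derivative k x) (at x)" and k: "continuous_on UNIV k" "\<And>x. 0 \<le> k x"
    and lo: "\<And>x. x \<le> 0 \<Longrightarrow> \<psi> x = 0" "\<And>x. x \<le> 0 \<Longrightarrow> k x = 0"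
    and hi: "\<And>x. h \<le> x \<Longrightarrow> \<psi> x = 1" "\<And>x. h \<le> x \<Longrightarrow> k x = 0"
    using C1_step_function[OF h(1)] by metis
  have mono: "\<psi> x \<le> \<psi> y" if "x \<le> y" for x y
    using that \<psi> k(2) by (meson DERIV_nonneg_imp_nondecreasing)
  define \<phi> \<phi>' where "\<phi> = (\<lambda>x. \<psi> (x - p) - \<psi> (x - q))" and "\<phi>' = (\<lambda>x. k (x - p) - k (x - q))"
  have shift: "((\<lambda>x. \<psi> (x - c)) has_real_derivative k (x - c)) (at x)" for x c
    using \<psi>[of "x - c"] DERIV_shift[of \<psi> "k (x - c)" x "- c"] by simp
  have \<phi>: "(\<phi> has_real_derivative \<phi>' x) (at x)" for x
    unfolding \<phi>_def \<phi>'_def by (intro DERIV_diff shift)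
  have kc: "continuous_on A (\<lambda>x. k (x - c))" for A c
    by (rule continuous_on_compose2[OF k(1)]) (auto intro!: continuous_intros)
  have \<phi>c: "continuous_on A \<phi>" "continuous_on A \<phi>'" for A
    unfolding \<phi>'_def
    by (blast intro: continuous_at_imp_continuous_on DERIV_isCont[OF \<phi>]) (intro continuous_intros kc)
  have supp: "\<phi> x = 0" "\<phi>' x = 0" if "x \<notin> {p..q + h}" for x
    using that pq lo hi by (auto simp: \<phi>_def \<phi>'_def not_le)
  have \<phi>0: "0 \<le> \<phi> x" for x using mono[of "x - q" "x - p"] pq by (simp add: \<phi>_def)
  \<comment> \<open>\<open>D1\<close> and \<open>D2\<close> are the two terms of the product rule
    for \<open>\<phi> * w\<close>. The first samples \<open>f\<close> near \<open>p\<close> and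
    \<open>q\<close>; the second combines with \<open>g * \<Phi>\<close> to give
    \<open>\<phi>\<close> times the expression in \<open>sign\<close>.\<close>
  define \<Phi> D1 D2 where "\<Phi> = (\<lambda>x. if x \<in> {l<..<r} then \<phi> x * w x else 0)"
    and "D1 = (\<lambda>x. if x \<in> {l<..<r} then \<phi>' x * w x else 0)"
    and "D2 = (\<lambda>x. if x \<in> {l<..<r} then \<phi> x * w' x else 0)"
  have cD: "continuous_on UNIV \<Phi>" "continuous_on UNIV D1" "continuous_on UNIV D2"
    unfolding \<Phi>_def D1_def D2_def
    by (rule continuous_on_extend_zero[OF _ pq(1) h(4)];
        (intro continuous_intros \<phi>c contw w' | simp add: supp del: atLeastAtMost_iff))+
  have \<Phi>: "(\<Phi> has_real_derivative D1 x + D2 x) (at x)" for x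
  proof (cases "x \<in> {l<..<r}")
    case True
    have "((\<lambda>x. \<phi> x * w x) has_real_derivative \<phi>' x * w x + \<phi> x * w' x) (at x)"
      using DERIV_mult[OF \<phi> w[OF True]] by (simp add: mult.commute)
    then have "(\<Phi> has_real_derivative \<phi>' x * w x + \<phi> x * w' x) (at x)"
      by (rule has_field_derivative_transform_within_open[of _ _ _ "{l<..<r}"])
        (use True in \<open>auto simp: \<Phi>_def\<close>)
    then show ?thesis using True by (simp add: D1_def D2_def)
  next
    case False
    then have x: "x \<notin> {p..q + h}" using pq h by auto
    have "((\<lambda>x. 0) has_real_derivative 0) (at x)" by simp
    then have "(\<Phi> has_real_derivative 0) (at x)"
      by (rule has_field_derivative_transform_within_open[of _ _ _ "- {p..q + h}"])
        (use x in \<open>auto simp: \<Phi>_def supp\<close>)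
    moreover have "D1 x + D2 x = 0" using False by (auto simp: D1_def D2_def)
    ultimately show ?thesis by simp
  qed
  have "\<Phi> \<in> test_functions"
    unfolding test_functions_def
  proof (intro CollectI conjI exI[of _ "{p..q + h}"] allI impI)
    show "\<Phi> C1_differentiable_on UNIV"
      unfolding C1_differentiable_on_def
      using \<Phi> cD by (intro exI[of _ "\<lambda>x. D1 x + D2 x"])
        (auto simp: has_real_derivative_iff_has_vector_derivative intro!: continuous_intros)
    show "{p..q + h} \<subseteq> {0<..<1}" using pq h lr by auto
    show "\<Phi> x = 0" if "x \<notin> {p..q + h}" for x using supp(1)[OF that] by (simp add: \<Phi>_def)
  qed simp
  moreover have "deriv \<Phi> = (\<lambda>x. D1 x + D2 x)"
    by (intro ext DERIV_imp_deriv \<Phi>)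
  ultimately have eq: "(LINT x|lebesgue01. u x * (D1 x + D2 x)) = - (LINT x|lebesgue01. g x * \<Phi> x)"
    using weak by (auto simp: is_weak_deriv_def)
  have int: "integrable lebesgue01 (\<lambda>x. u x * D1 x)" "integrable lebesgue01 (\<lambda>x. u x * D2 x)"
    "integrable lebesgue01 (\<lambda>x. g x * \<Phi> x)"
    using L1_mult_continuous u g cD by (auto simp: L1_def intro: continuous_on_subset)
  have intk: "(\<lambda>x. k (x - c)) \<in> L1" for c
    by (intro continuous_in_L1 kc)
  have lintk: "(LINT x|lebesgue01. k (x - c)) = 1" if "0 < c" "c + h < 1" for c
  proof -
    have "((\<lambda>x. k (x - c)) has_integral (\<psi> (1 - c) - \<psi> (0 - c))) {0..1}"
      using shift[of c] by (intro fundamental_theorem_of_calculus)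
        (simp_all add: has_vector_derivative_at_within has_real_derivative_iff_has_vector_derivative)
    then show ?thesis
      using L1_integrable_on(3)[OF intk, of 0 1 c] that lo(1)[of "-c"] hi(1)[of "1 - c"]
      by (simp add: integral_unique)
  qed
  \<comment> \<open>Both bumps have unit mass, so replacing \<open>f\<close> by the levels on their
    supports bounds the integral of \<open>u * D1\<close> from below by \<open>m1 - m2 > 0\<close>.
    The weak derivative identity and \<open>sign\<close> make the same integral nonpositive.\<close>
  have "m1 - m2 = (LINT x|lebesgue01. m1 * k (x - p) - m2 * k (x - q))"
    using intk pq h lr by (simp add: L1_def lintk)
  also have "\<dots> \<le> (LINT x|lebesgue01. u x * D1 x)"
  proof (rule integral_mono)
    show "integrable lebesgue01 (\<lambda>x. m1 * k (x - p) - m2 * k (x - q))"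
      using intk by (simp add: L1_def)
    fix x
    have "m1 * k (x - p) \<le> f x * k (x - p)"
    proof (cases "x \<in> {p..p + h}")
      case True
      then show ?thesis using h h1(2)[of x] k(2) by (intro mult_right_mono) (auto simp: dist_real_def)
    qed (use lo hi in \<open>auto simp: not_le\<close>)
    moreover have "f x * k (x - q) \<le> m2 * k (x - q)"
    proof (cases "x \<in> {q..q + h}")
      case True
      then show ?thesis using h h2(2)[of x] k(2) by (intro mult_right_mono) (auto simp: dist_real_def)
    qed (use lo hi in \<open>auto simp: not_le\<close>)
    moreover have "u x * D1 x = f x * k (x - p) - f x * k (x - q)"
    proof (cases "x \<in> {l<..<r}")
      case False
      then have "\<phi>' x = 0" "k (x - p) = 0" "k (x - q) = 0" using pq h lo hi by (auto simp: \<phi>'_def)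
      then show ?thesis using False by (auto simp: D1_def)
    qed (auto simp: D1_def f_def \<phi>'_def algebra_simps)
    ultimately show "m1 * k (x - p) - m2 * k (x - q) \<le> u x * D1 x" by simp
  qed fact
  also have "\<dots> = - (LINT x|lebesgue01. g x * \<Phi> x + u x * D2 x)"
    using eq int by (simp add: distrib_left)
  finally have "m1 - m2 \<le> - (LINT x|lebesgue01. g x * \<Phi> x + u x * D2 x)" .
  moreover have "(LINT x|lebesgue01. g x * \<Phi> x + u x * D2 x) \<ge> 0"
  proof (rule integral_nonneg_AE)
    show "AE x in lebesgue01. 0 \<le> g x * \<Phi> x + u x * D2 x"
      using sign
    proof eventually_elim
      fix x assume x: "x \<in> {l<..<r} \<longrightarrow> 0 \<le> g x * w x + u x * w' x"
      show "0 \<le> g x * \<Phi> x + u x * D2 x"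
      proof (cases "x \<in> {l<..<r}")
        case True
        then have "0 \<le> \<phi> x * (g x * w x + u x * w' x)" using x \<phi>0 by simp
        then show ?thesis using True by (simp add: \<Phi>_def D2_def algebra_simps)
      qed (auto simp: \<Phi>_def D2_def)
    qed
  qed
  ultimately show False using m1 by simp
qed

section \<open>Degenerate coefficients\<close>

text \<open>
  The differential inequality says that \<open>a x / \<bar>x - x0\<bar> powr K\<close> decreases away from \<open>x0\<close>.
\<close>

lemma degenerate_lower_bound:
  assumes a: "a \<in> W11" "continuous_on {0..1} a" and x0: "x0 \<in> {0<..<1}" and K: "0 < K"
    and pos: "\<And>x. x \<in> {0..1} - {x0} \<Longrightarrow> 0 < a x"
    and AE: "AE x in lebesgue_on {0..1}. (x - x0) * wderiv a x \<le> K * a x"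
  obtains c where "0 < c" "\<And>x. x \<in> {0<..<1} - {x0} \<Longrightarrow> c * \<bar>x - x0\<bar> powr K \<le> a x"
proof -
  have a1: "a \<in> L1" using a(1) by (simp add: W11_def)
  have AE1: "AE x in lebesgue01. (x - x0) * wderiv a x \<le> K * a x"
    using AE by (auto simp: AE_restrict_space_iff elim!: eventually_mono)
  have cont: "continuous_on {l<..<r} a" if "0 \<le> l" "r \<le> 1" for l r
    by (rule continuous_on_subset[OF a(2)]) (use that in auto)
  have right: "a q * (q - x0) powr - K \<le> a p * (p - x0) powr - K" if "x0 < p" "p < q" "q < 1" for p q
  proof -
    \<comment> \<open>On the right of \<open>x0\<close> the quotient decreases, so the weight is
      taken with a minus sign to fit a lemma about increasing products.\<close>
    have "a p * - ((p - x0) powr - K) \<le> a q * - ((q - x0) powr - K)"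
    proof (rule weak_deriv_nonneg_imp_mono[OF a1 wderiv_W11[OF a(1)], of x0 1 "\<lambda>x. - ((x - x0) powr - K)"
          "\<lambda>x. K * (x - x0) powr (- K - 1)"])
      fix x assume x: "x \<in> {x0<..<1}"
      show "((\<lambda>x. - ((x - x0) powr - K)) has_real_derivative K * (x - x0) powr (- K - 1)) (at x)"
        using x by (auto intro!: derivative_eq_intros)
    next
      show "continuous_on {x0<..<1} (\<lambda>x. K * (x - x0) powr (- K - 1))"
        by (auto intro!: continuous_intros)
      show "AE x in lebesgue01. x \<in> {x0<..<1} \<longrightarrow>
          0 \<le> wderiv a x * - ((x - x0) powr - K) + a x * (K * (x - x0) powr (- K - 1))"
        using AE1
      proof (eventually_elim, intro impI)
        fix x assume *: "(x - x0) * wderiv a x \<le> K * a x" "x \<in> {x0<..<1}"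
        \<comment> \<open>Factoring out the positive power of exponent \<open>- K - 1\<close> leaves
          exactly the difference of the two sides of the degeneracy inequality.\<close>
        have "(x - x0) powr - K = (x - x0) powr (- K - 1) * (x - x0)"
          using powr_add[of "x - x0" "- K - 1" 1] * by simp
        then have "wderiv a x * - ((x - x0) powr - K) + a x * (K * (x - x0) powr (- K - 1))
          = (x - x0) powr (- K - 1) * (K * a x - (x - x0) * wderiv a x)"
          by (simp only:) (simp add: algebra_simps)
        then show "0 \<le> wderiv a x * - ((x - x0) powr - K) + a x * (K * (x - x0) powr (- K - 1))"
          using * by simp
      qed
    qed (use x0 that cont[of x0 1] in auto)
    then show ?thesis by simp
  qed
  have left: "a p * (x0 - p) powr - K \<le> a q * (x0 - q) powr - K" if "0 < p" "p < q" "q < x0" for p q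
  proof (rule weak_deriv_nonneg_imp_mono[OF a1 wderiv_W11[OF a(1)], of 0 x0 "\<lambda>x. (x0 - x) powr - K"
        "\<lambda>x. K * (x0 - x) powr (- K - 1)"])
    fix x assume x: "x \<in> {0<..<x0}"
    show "((\<lambda>x. (x0 - x) powr - K) has_real_derivative K * (x0 - x) powr (- K - 1)) (at x)"
      using x by (auto intro!: derivative_eq_intros)
  next
    show "continuous_on {0<..<x0} (\<lambda>x. K * (x0 - x) powr (- K - 1))"
      by (auto intro!: continuous_intros)
    show "AE x in lebesgue01. x \<in> {0<..<x0} \<longrightarrow>
        0 \<le> wderiv a x * (x0 - x) powr - K + a x * (K * (x0 - x) powr (- K - 1))"
      using AE1
    proof (eventually_elim, intro impI)
      fix x assume *: "(x - x0) * wderiv a x \<le> K * a x" "x \<in> {0<..<x0}"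
      have "(x0 - x) powr - K = (x0 - x) powr (- K - 1) * (x0 - x)"
        using powr_add[of "x0 - x" "- K - 1" 1] * by simp
      then have "wderiv a x * (x0 - x) powr - K + a x * (K * (x0 - x) powr (- K - 1))
        = (x0 - x) powr (- K - 1) * (K * a x - (x - x0) * wderiv a x)"
        by (simp only:) (simp add: algebra_simps)
      then show "0 \<le> wderiv a x * (x0 - x) powr - K + a x * (K * (x0 - x) powr (- K - 1))"
        using * by simp
    qed
  qed (use x0 that cont[of 0 x0] in auto)
  \<comment> \<open>Outside the \<open>\<delta>\<close>-neighbourhood of \<open>x0\<close>,
    compactness gives a positive minimum \<open>a z\<close>, which is the constant sought. Inside,
    monotonicity compares \<open>a x\<close> with the value of \<open>a\<close> at
    \<open>x0 + \<delta>\<close> or \<open>x0 - \<delta>\<close>; there \<open>\<delta> < 1\<close>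
    makes \<open>\<delta> powr - K\<close> at least 1, so no smaller constant is required.\<close>
  define \<delta> where "\<delta> = min x0 (1 - x0) / 2"
  have \<delta>: "0 < \<delta>" "\<delta> < x0" "\<delta> < 1 - x0" "\<delta> < 1"
    using x0 by (auto simp: \<delta>_def min_def)
  let ?S = "{0..1} - {x0 - \<delta><..<x0 + \<delta>}"
  have "compact ?S" by (intro compact_diff) auto
  moreover have "x0 + \<delta> \<in> ?S" using \<delta> x0 by auto
  ultimately obtain z where z: "z \<in> ?S" "\<And>y. y \<in> ?S \<Longrightarrow> a z \<le> a y"
    using continuous_attains_inf[of ?S a] continuous_on_subset[OF a(2), of ?S] by blast
  have az: "0 < a z" using z(1) \<delta> pos[of z] by auto
  have powK: "t * \<delta> powr - K \<ge> t" if "t \<ge> 0" for t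
    using mult_left_mono[OF _ that, of 1 "\<delta> powr - K"] \<delta> K by (simp add: powr_minus powr_le1 one_le_inverse)
  show thesis
  proof (rule that[OF az])
    fix x assume x: "x \<in> {0<..<1} - {x0}"
    show "a z * \<bar>x - x0\<bar> powr K \<le> a x"
    proof (cases "x \<in> ?S")
      case True
      have "\<bar>x - x0\<bar> powr K \<le> 1" using x x0 K by (intro powr_le1) auto
      then have "a z * \<bar>x - x0\<bar> powr K \<le> a z" using az by simp
      then show ?thesis using z(2)[OF True] by simp
    next
      case False
      have "a z \<le> a x * \<bar>x - x0\<bar> powr - K"
      proof (cases "x0 < x")
        case True
        have "a z \<le> a (x0 + \<delta>)" using \<delta> x0 by (intro z) auto
        also have "\<dots> \<le> a (x0 + \<delta>) * \<delta> powr - K" using \<delta> x0 pos[of "x0 + \<delta>"] by (intro powK) auto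
        also have "\<dots> \<le> a x * \<bar>x - x0\<bar> powr - K" using right[of x "x0 + \<delta>"] True False x \<delta> by auto
        finally show ?thesis .
      next
        case left': False
        have "a z \<le> a (x0 - \<delta>)" using \<delta> x0 by (intro z) auto
        also have "\<dots> \<le> a (x0 - \<delta>) * \<delta> powr - K" using \<delta> x0 pos[of "x0 - \<delta>"] by (intro powK) auto
        also have "\<dots> \<le> a x * \<bar>x - x0\<bar> powr - K" using left[of "x0 - \<delta>" x] left' False x \<delta> by auto
        finally show ?thesis .
      qed
      then have "a z * \<bar>x - x0\<bar> powr K \<le> a x * \<bar>x - x0\<bar> powr - K * \<bar>x - x0\<bar> powr K"
        by (intro mult_right_mono) auto
      also have "\<dots> = a x" using x by (simp flip: powr_add mult.assoc add: mult.assoc)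
      finally show ?thesis .
    qed
  qed
qed

section \<open>Lipschitz coefficients, the weighted estimate, and vanishing at the
  degeneracy\<close>

lemma Linf_imp_L1: "f \<in> Linf \<Longrightarrow> f \<in> L1"
  by (auto simp: Linf_def L1_def intro!: finite_measure.integrable_const_bound finite_measure_lebesgue_on)

text \<open>Adding a linear function turns a bound on the weak derivative into a sign, as the
  Lipschitz estimate requires. The identity for the linear part is the fundamental theorem of
  calculus for \<open>x * \<phi> x\<close>, which vanishes at 0 and at 1.\<close>

lemma is_weak_deriv_add_linear:
  assumes "u \<in> L1" "g \<in> L1" "is_weak_deriv u g"
  shows "is_weak_deriv (\<lambda>x. u x + c * x) (\<lambda>x. g x + c)"
  unfolding is_weak_deriv_def
proof
  fix \<phi> assume \<phi>: "\<phi> \<in> test_functions"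
  note d = test_functionD[OF \<phi>]
  have cont: "continuous_on {0..1} \<phi>" "continuous_on {0..1} (deriv \<phi>)"
    by (intro continuous_at_imp_continuous_on ballI DERIV_isCont[OF d(1)])
      (rule continuous_on_subset[OF d(2)], simp)
  have int: "integrable lebesgue01 (\<lambda>x. u x * deriv \<phi> x)" "integrable lebesgue01 (\<lambda>x. g x * \<phi> x)"
    "integrable lebesgue01 (\<lambda>x. x * deriv \<phi> x)" "integrable lebesgue01 \<phi>"
    using L1_mult_continuous[OF assms(1) cont(2)] L1_mult_continuous[OF assms(2) cont(1)]
      L1_mult_continuous[OF continuous_in_L1[OF continuous_on_id] cont(2)] continuous_in_L1[OF cont(1)]
    by (simp_all add: L1_def)
  have "((\<lambda>x. x * \<phi> x) has_real_derivative x * deriv \<phi> x + \<phi> x) (at x)" for x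
    using DERIV_mult[OF DERIV_ident d(1), of x] by (simp add: algebra_simps)
  then have "((\<lambda>x. x * deriv \<phi> x + \<phi> x) has_integral (1 * \<phi> 1 - 0 * \<phi> 0)) {0..1}"
    by (intro fundamental_theorem_of_calculus)
      (simp_all add: has_vector_derivative_at_within has_real_derivative_iff_has_vector_derivative)
  then have "(LINT x|lebesgue01. x * deriv \<phi> x + \<phi> x) = 0"
    using L1_integrable_on(3)[of "\<lambda>x. x * deriv \<phi> x + \<phi> x" 0 1] int d(3)[of 1]
    by (simp add: L1_def integral_unique)
  then have "(LINT x|lebesgue01. x * deriv \<phi> x) = - (LINT x|lebesgue01. \<phi> x)"
    using int by simp
  then have "c * (LINT x|lebesgue01. x * deriv \<phi> x) = - (c * (LINT x|lebesgue01. \<phi> x))"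
    by simp
  moreover have "(LINT x|lebesgue01. u x * deriv \<phi> x) = - (LINT x|lebesgue01. g x * \<phi> x)"
    using assms(3) \<phi> by (simp add: is_weak_deriv_def)
  ultimately show "(LINT x|lebesgue01. (u x + c * x) * deriv \<phi> x) = - (LINT x|lebesgue01. (g x + c) * \<phi> x)"
    using int by (simp add: distrib_right mult.assoc)
qed

text \<open>If \<open>M\<close> bounds the absolute value of the weak derivative, then
  \<open>b x + M * x\<close> is nondecreasing and \<open>b x - M * x\<close> is nonincreasing. Both
  follow from \<open>weak_deriv_nonneg_imp_mono\<close> with the constant weights 1 and -1.\<close>

lemma W1inf_Lipschitz:
  assumes "b \<in> W1inf" "continuous_on {0<..<1} b"
  obtains M where "0 < M" "\<And>x y. x \<in> {0<..<1} \<Longrightarrow> y \<in> {0<..<1} \<Longrightarrow> \<bar>b x - b y\<bar> \<le> M * \<bar>x - y\<bar>"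
proof -
  from assms(1) obtain g M0 where b: "b \<in> L1" and g: "g \<in> L1" and weak: "is_weak_deriv b g"
    and M0: "AE x in lebesgue01. \<bar>g x\<bar> \<le> M0"
    using Linf_imp_L1 by (auto simp: W1inf_def Linf_def)
  define M where "M = max M0 1"
  have M: "AE x in lebesgue01. \<bar>g x\<bar> \<le> M" using M0 by eventually_elim (simp add: M_def)
  have lin: "(\<lambda>x. c * x) \<in> L1" for c by (intro continuous_in_L1 continuous_intros)
  have const: "(\<lambda>x. c) \<in> L1" for c :: real by (intro continuous_in_L1 continuous_intros)
  have L1: "(\<lambda>x. b x + c * x) \<in> L1" "(\<lambda>x. g x + c) \<in> L1" for c
    using b g lin[of c] const[of c] by (simp_all add: L1_def)
  have incr: "(b p + M * p) * 1 \<le> (b q + M * q) * 1" if "0 < p" "p < q" "q < 1" for p q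
    by (rule weak_deriv_nonneg_imp_mono[OF L1 is_weak_deriv_add_linear[OF b g weak],
          where l = 0 and r = 1 and w = "\<lambda>_. 1" and w' = "\<lambda>_. 0"])
      (use that M assms(2) in \<open>auto intro!: continuous_intros elim!: eventually_mono\<close>)
  have decr: "(b p + - M * p) * - 1 \<le> (b q + - M * q) * - 1" if "0 < p" "p < q" "q < 1" for p q
    by (rule weak_deriv_nonneg_imp_mono[OF L1 is_weak_deriv_add_linear[OF b g weak],
          where l = 0 and r = 1 and w = "\<lambda>_. - 1" and w' = "\<lambda>_. 0"])
      (use that M assms(2) in \<open>auto intro!: continuous_intros elim!: eventually_mono\<close>)
  have "\<bar>b x - b y\<bar> \<le> M * \<bar>x - y\<bar>" if "x \<in> {0<..<1}" "y \<in> {0<..<1}" for x y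
    using that incr[of x y] incr[of y x] decr[of x y] decr[of y x]
    by (cases x y rule: linorder_cases) (auto simp: abs_if algebra_simps)
  moreover have "0 < M" by (simp add: M_def)
  ultimately show ?thesis using that by blast
qed

lemma nn_integral_reciprocal_eq_top:
  fixes c \<delta> :: real
  assumes "0 < \<delta>"
  shows "(\<integral>\<^sup>+x. indicator {c<..c + \<delta>} x * ennreal (1 / \<bar>x - c\<bar>) \<partial>lborel) = \<infinity>" (is "?I = _")
proof (rule ccontr)
  assume "?I \<noteq> \<infinity>"
  then obtain B where B: "0 \<le> B" "?I = ennreal B" by (cases ?I) auto
  \<comment> \<open>Chosen so that the logarithm of \<open>\<delta> / \<epsilon>\<close> is
    \<open>B + 1\<close>: already the part of the integral over
    \<open>[c + \<epsilon>, c + \<delta>]\<close> exceeds the supposed value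
    \<open>B\<close>.\<close>
  define \<epsilon> where "\<epsilon> = \<delta> * exp (- (B + 1))"
  have "exp (- (B + 1)) < 1" using B(1) by simp
  then have \<epsilon>: "0 < \<epsilon>" "\<epsilon> \<le> \<delta>" using assms by (auto simp: \<epsilon>_def mult_le_cancel_left1)
  have "((\<lambda>x. 1 / (x - c)) has_integral (ln (c + \<delta> - c) - ln (c + \<epsilon> - c))) {c + \<epsilon>..c + \<delta>}"
  proof (rule fundamental_theorem_of_calculus)
    fix x assume "x \<in> {c + \<epsilon>..c + \<delta>}"
    then have "((\<lambda>x. ln (x - c)) has_real_derivative 1 / (x - c)) (at x within {c + \<epsilon>..c + \<delta>})"
      using \<epsilon> by (auto intro!: derivative_eq_intros)
    then show "((\<lambda>x. ln (x - c)) has_vector_derivative 1 / (x - c)) (at x within {c + \<epsilon>..c + \<delta>})"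
      by (simp add: has_real_derivative_iff_has_vector_derivative)
  qed (use \<epsilon> in simp)
  moreover have "ln (c + \<delta> - c) - ln (c + \<epsilon> - c) = B + 1"
    using assms by (simp add: \<epsilon>_def ln_mult)
  ultimately have "((\<lambda>x. 1 / (x - c)) has_integral (B + 1)) {c + \<epsilon>..c + \<delta>}" by simp
  from nn_integral_has_integral_lebesgue[OF _ this]
  have "(\<integral>\<^sup>+x. ennreal (indicator {c + \<epsilon>..c + \<delta>} x * (1 / (x - c))) \<partial>lborel) = ennreal (B + 1)"
    using \<epsilon> by simp
  moreover have "(\<integral>\<^sup>+x. ennreal (indicator {c + \<epsilon>..c + \<delta>} x * (1 / (x - c))) \<partial>lborel) \<le> ?I"
    by (rule nn_integral_mono) (use \<epsilon> in \<open>auto simp: indicator_def\<close>)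
  ultimately show False using B by simp
qed

text \<open>Distances to \<open>x0\<close> are below 1 on the interval, so powers decrease in the
  exponent. Hence \<open>1 / b\<close> is at most \<open>1 / c2\<close> times the power of exponent
  \<open>\<alpha> - 2\<close>, and the power of exponent \<open>\<alpha>\<close> is at most
  \<open>a / c1\<close>. The pure power inequality \<open>kernel\<close> links the two. Leaving
  \<open>R\<close> abstract covers integration both from \<open>x0\<close> and from the end
  points.\<close>

lemma weighted_Hardy_inequality:
  fixes a b u g :: "real \<Rightarrow> real"
  assumes R [measurable]: "Measurable.pred (lborel \<Otimes>\<^sub>M lborel) (\<lambda>(x, s). R x s)"
    and kernel: "\<And>G :: real \<Rightarrow> ennreal. G \<in> borel_measurable borel \<Longrightarrow>
      (\<integral>\<^sup>+x. ennreal (\<bar>x - x0\<bar> powr (\<alpha> - 2)) * (\<integral>\<^sup>+s. indicator {s. R x s} s * G s \<partial>lborel)\<^sup>2 \<partial>lborel)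
      \<le> ennreal C * (\<integral>\<^sup>+s. ennreal (\<bar>s - x0\<bar> powr \<alpha>) * (G s)\<^sup>2 \<partial>lborel)"
    and C: "0 \<le> C" and K: "K1 \<le> \<alpha>" "\<alpha> \<le> 2 - K2"
    and c: "0 < c1" "0 < c2" and x0: "x0 \<in> {0<..<1}"
    and a: "\<And>x. x \<in> {0<..<1} - {x0} \<Longrightarrow> c1 * \<bar>x - x0\<bar> powr K1 \<le> a x"
    and b: "\<And>x. x \<in> {0<..<1} - {x0} \<Longrightarrow> c2 * \<bar>x - x0\<bar> powr K2 \<le> b x"
    and g: "g \<in> borel_measurable lebesgue01"
    and int: "integrable lebesgue01 (\<lambda>x. a x * (g x)\<^sup>2)" "integrable lebesgue01 (\<lambda>x. (u x)\<^sup>2 / b x)"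
    and u: "AE x in lebesgue01. ennreal \<bar>u x\<bar>
      \<le> (\<integral>\<^sup>+s. indicator {s. R x s} s * (indicator {0<..<1} s * ennreal \<bar>g s\<bar>) \<partial>lebesgue)"
  shows "(LINT x|lebesgue01. (u x)\<^sup>2 / b x) \<le> C / (c1 * c2) * (LINT x|lebesgue01. a x * (g x)\<^sup>2)"
proof -
  let ?d = "\<lambda>x. \<bar>x - x0\<bar>" and ?I = "indicator {0<..<1} :: real \<Rightarrow> ennreal"
  have ne: "AE x in lborel. x \<noteq> x0" by (rule AE_lborel_singleton)
  \<comment> \<open>The function \<open>g\<close> is only Lebesgue measurable on the interval,
    whereas \<open>kernel\<close> expects a Borel function on the line. Extend \<open>g\<close> by
    zero and pass to a Borel function equal to it almost everywhere.\<close>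
  have "(\<lambda>x. if x \<in> {0<..<1} then g x else 0) \<in> borel_measurable lebesgue"
    using g by (intro borel_measurable_if_I) auto
  from completion_ex_borel_measurable_real[OF this]
  obtain g' where [measurable]: "g' \<in> borel_measurable borel"
    and g': "AE x in lborel. (if x \<in> {0<..<1} then g x else 0) = g' x" by auto
  define G where "G = (\<lambda>x. ennreal \<bar>g' x\<bar>)"
  have [measurable]: "G \<in> borel_measurable borel" unfolding G_def by measurable
  have G: "AE x in lborel. ?I x * ennreal \<bar>g x\<bar> = G x"
    using g' by eventually_elim (auto simp: G_def indicator_def split: if_splits)
  define W where "W = (\<lambda>x. \<integral>\<^sup>+s. indicator {s. R x s} s * G s \<partial>lborel)"
  have [measurable]: "W \<in> borel_measurable borel"
    using R unfolding W_def indicator_def by measurable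
  have W: "(\<integral>\<^sup>+s. indicator {s. R x s} s * (?I s * ennreal \<bar>g s\<bar>) \<partial>lebesgue) = W x" for x
    unfolding W_def nn_integral_completion
    by (rule nn_integral_cong_AE) (use G in eventually_elim, simp)
  have pos: "0 < a x" "0 < b x" if "x \<in> {0<..<1} - {x0}" for x
    using a[OF that] b[OF that] c that by (auto elim!: less_le_trans[rotated])
  have ne01: "AE x in lebesgue01. x \<in> {0<..<1} - {x0}"
    using AE_completion[OF ne] by (auto simp: AE_restrict_space_iff elim!: eventually_mono)
  have nonneg: "AE x in lebesgue01. 0 \<le> a x * (g x)\<^sup>2" "AE x in lebesgue01. 0 \<le> (u x)\<^sup>2 / b x"
    using ne01 by (eventually_elim, use pos in \<open>simp add: less_imp_le\<close>)+
  have "AE x in lebesgue01. ennreal ((u x)\<^sup>2 / b x) \<le> ennreal (1 / c2) * (ennreal (?d x powr (\<alpha> - 2)) * (W x)\<^sup>2)"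
    using u ne01
  proof eventually_elim
    fix x assume ux: "ennreal \<bar>u x\<bar> \<le> (\<integral>\<^sup>+s. indicator {s. R x s} s * (?I s * ennreal \<bar>g s\<bar>) \<partial>lebesgue)"
      and x: "x \<in> {0<..<1} - {x0}"
    have "1 / b x \<le> 1 / (c2 * ?d x powr K2)"
      using b[OF x] c x by (intro divide_left_mono mult_pos_pos) (auto intro: pos)
    also have "\<dots> = 1 / c2 * ?d x powr - K2" by (simp add: powr_minus divide_simps)
    also have "\<dots> \<le> 1 / c2 * ?d x powr (\<alpha> - 2)"
      using K c x x0 by (intro mult_left_mono powr_mono') auto
    finally have "1 / b x * (u x)\<^sup>2 \<le> 1 / c2 * ?d x powr (\<alpha> - 2) * (u x)\<^sup>2"
      by (intro mult_right_mono) auto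
    then have "ennreal ((u x)\<^sup>2 / b x) \<le> ennreal (1 / c2 * (?d x powr (\<alpha> - 2) * \<bar>u x\<bar>\<^sup>2))"
      by (intro ennreal_leI) (simp add: mult.assoc)
    also have "\<dots> = ennreal (1 / c2) * (ennreal (?d x powr (\<alpha> - 2)) * (ennreal \<bar>u x\<bar>)\<^sup>2)"
      using c by (simp add: ennreal_mult ennreal_power del: power2_abs times_divide_eq_left)
    also have "\<dots> \<le> ennreal (1 / c2) * (ennreal (?d x powr (\<alpha> - 2)) * (W x)\<^sup>2)"
      using ux unfolding W by (intro mult_left_mono power_mono) auto
    finally show "ennreal ((u x)\<^sup>2 / b x) \<le> ennreal (1 / c2) * (ennreal (?d x powr (\<alpha> - 2)) * (W x)\<^sup>2)" .
  qed
  then have "(\<integral>\<^sup>+x. ennreal ((u x)\<^sup>2 / b x) \<partial>lebesgue01)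
    \<le> (\<integral>\<^sup>+x. ennreal (1 / c2) * (ennreal (?d x powr (\<alpha> - 2)) * (W x)\<^sup>2) \<partial>lebesgue01)"
    by (rule nn_integral_mono_AE)
  also have "\<dots> \<le> (\<integral>\<^sup>+x. ennreal (1 / c2) * (ennreal (?d x powr (\<alpha> - 2)) * (W x)\<^sup>2) \<partial>lborel)"
    by (subst nn_integral_restrict_space) (auto simp: nn_integral_completion indicator_def intro!: nn_integral_mono)
  also have "\<dots> = ennreal (1 / c2) * (\<integral>\<^sup>+x. ennreal (?d x powr (\<alpha> - 2)) * (W x)\<^sup>2 \<partial>lborel)"
    by (rule nn_integral_cmult) measurable
  also have "\<dots> \<le> ennreal (1 / c2) * (ennreal C * (\<integral>\<^sup>+s. ennreal (?d s powr \<alpha>) * (G s)\<^sup>2 \<partial>lborel))"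
    unfolding W_def by (intro mult_left_mono kernel) auto
  also have "(\<integral>\<^sup>+s. ennreal (?d s powr \<alpha>) * (G s)\<^sup>2 \<partial>lborel)
    \<le> (\<integral>\<^sup>+s. ennreal (1 / c1) * (ennreal (a s * (g s)\<^sup>2) * ?I s) \<partial>lborel)"
  proof (rule nn_integral_mono_AE)
    show "AE s in lborel. ennreal (?d s powr \<alpha>) * (G s)\<^sup>2 \<le> ennreal (1 / c1) * (ennreal (a s * (g s)\<^sup>2) * ?I s)"
      using G ne
    proof eventually_elim
      fix s assume s: "?I s * ennreal \<bar>g s\<bar> = G s" "s \<noteq> x0"
      show "ennreal (?d s powr \<alpha>) * (G s)\<^sup>2 \<le> ennreal (1 / c1) * (ennreal (a s * (g s)\<^sup>2) * ?I s)"
      proof (cases "s \<in> {0<..<1}")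
        case True
        then have s': "s \<in> {0<..<1} - {x0}" using s by auto
        have "?d s powr \<alpha> \<le> ?d s powr K1" using K s' x0 by (intro powr_mono') auto
        also have "\<dots> \<le> 1 / c1 * a s" using a[OF s'] c by (simp add: field_simps)
        finally have "?d s powr \<alpha> * (g s)\<^sup>2 \<le> 1 / c1 * a s * (g s)\<^sup>2" by (rule mult_right_mono) simp
        then have "ennreal (?d s powr \<alpha> * \<bar>g s\<bar>\<^sup>2) \<le> ennreal (1 / c1 * (a s * (g s)\<^sup>2))"
          by (intro ennreal_leI) (simp add: mult.assoc)
        also have "\<dots> = ennreal (1 / c1) * ennreal (a s * (g s)\<^sup>2)"
          using c pos(1)[OF s'] by (subst ennreal_mult) auto
        finally show ?thesis
          using True s(1) by (simp add: ennreal_mult ennreal_power del: power2_abs flip: s(1))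
      qed (use s in auto)
    qed
  qed
  also have "(\<integral>\<^sup>+s. ennreal (1 / c1) * (ennreal (a s * (g s)\<^sup>2) * ?I s) \<partial>lborel)
     = (\<integral>\<^sup>+s. ennreal (1 / c1) * (ennreal (a s * (g s)\<^sup>2) * ?I s) \<partial>lebesgue)"
    by (simp add: nn_integral_completion)
  also have "\<dots> = (\<integral>\<^sup>+s. ennreal (1 / c1) * ennreal (a s * (g s)\<^sup>2) \<partial>lebesgue01)"
    by (subst nn_integral_restrict_space) (auto simp: mult.assoc)
  also have "\<dots> = ennreal (1 / c1) * (\<integral>\<^sup>+s. ennreal (a s * (g s)\<^sup>2) \<partial>lebesgue01)"
    using int(1) by (intro nn_integral_cmult) auto
  also have "(\<integral>\<^sup>+s. ennreal (a s * (g s)\<^sup>2) \<partial>lebesgue01) = ennreal (LINT s|lebesgue01. a s * (g s)\<^sup>2)"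
    by (intro nn_integral_eq_integral int nonneg)
  finally have "(\<integral>\<^sup>+x. ennreal ((u x)\<^sup>2 / b x) \<partial>lebesgue01)
     \<le> ennreal (1 / c2) * (ennreal C * (ennreal (1 / c1) * ennreal (LINT s|lebesgue01. a s * (g s)\<^sup>2)))"
    by (simp add: mult_left_mono)
  moreover have "0 \<le> (LINT s|lebesgue01. a s * (g s)\<^sup>2)"
    by (intro integral_nonneg_AE nonneg)
  moreover have "(\<integral>\<^sup>+x. ennreal ((u x)\<^sup>2 / b x) \<partial>lebesgue01) = ennreal (LINT x|lebesgue01. (u x)\<^sup>2 / b x)"
    by (intro nn_integral_eq_integral int nonneg)
  ultimately have "ennreal (LINT x|lebesgue01. (u x)\<^sup>2 / b x)
      \<le> ennreal (1 / c2 * (C * (1 / c1 * (LINT s|lebesgue01. a s * (g s)\<^sup>2))))"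
    using c C by (simp add: ennreal_mult del: times_divide_eq_left times_divide_eq_right)
  then show ?thesis
    using c C \<open>0 \<le> (LINT s|lebesgue01. a s * (g s)\<^sup>2)\<close> by (subst (asm) ennreal_le_iff) (auto simp: mult_ac)
qed

text \<open>If \<open>U x0\<close> were nonzero, continuity would keep the absolute value of
  \<open>U\<close> above half of its value at \<open>x0\<close> nearby. Since \<open>b\<close> grows
  at most linearly, the quotient would dominate \<open>\<eta>\<close> divided by the distance to
  \<open>x0\<close>, which is not integrable. A neighbourhood on the right of \<open>x0\<close>
  suffices.\<close>

lemma primitive_vanishes_at_degeneracy:
  fixes b u U :: "real \<Rightarrow> real"
  assumes x0: "x0 \<in> {0<..<1}" and U: "continuous_on {0..1} U" and u: "AE x in lebesgue01. u x = U x"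
    and b: "0 < M" "\<And>x. x \<in> {0<..<1} - {x0} \<Longrightarrow> 0 < b x \<and> b x \<le> M * \<bar>x - x0\<bar>"
    and int: "integrable lebesgue01 (\<lambda>x. (u x)\<^sup>2 / b x)"
  shows "U x0 = 0"
proof (rule ccontr)
  assume nz: "U x0 \<noteq> 0"
  define \<eta> where "\<eta> = (\<bar>U x0\<bar> / 2)\<^sup>2 / M"
  have \<eta>: "0 < \<eta>" using nz b(1) by (simp add: \<eta>_def)
  obtain e where e: "0 < e" "\<And>x. x \<in> {0..1} \<Longrightarrow> dist x x0 < e \<Longrightarrow> dist (U x) (U x0) < \<bar>U x0\<bar> / 2"
    using U x0 nz unfolding continuous_on_iff by (metis (no_types) atLeastAtMost_iff greaterThanLessThan_iff half_gt_zero less_imp_le zero_less_abs_iff)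
  define \<delta> where "\<delta> = min e (1 - x0) / 2"
  have \<delta>: "0 < \<delta>" "\<delta> < e" "x0 + \<delta> < 1" using e(1) x0 by (auto simp: \<delta>_def min_def field_simps)
  let ?J = "\<lambda>x. indicator {x0<..x0 + \<delta>} x * ennreal (1 / \<bar>x - x0\<bar>)"
  have "(\<integral>\<^sup>+x. ennreal \<eta> * ?J x \<partial>lborel) = (\<integral>\<^sup>+x. ennreal \<eta> * ?J x \<partial>lebesgue)"
    by (simp add: nn_integral_completion)
  also have "\<dots> \<le> (\<integral>\<^sup>+x. ennreal (norm ((u x)\<^sup>2 / b x)) * indicator {0<..<1} x \<partial>lebesgue)"
  proof (rule nn_integral_mono_AE)
    have "AE x in lebesgue. x \<in> {0<..<1} \<longrightarrow> u x = U x"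
      using u by (simp add: AE_restrict_space_iff)
    then show "AE x in lebesgue. ennreal \<eta> * ?J x \<le> ennreal (norm ((u x)\<^sup>2 / b x)) * indicator {0<..<1} x"
    proof eventually_elim
      fix x assume ux: "x \<in> {0<..<1} \<longrightarrow> u x = U x"
      show "ennreal \<eta> * ?J x \<le> ennreal (norm ((u x)\<^sup>2 / b x)) * indicator {0<..<1} x"
      proof (cases "x \<in> {x0<..x0 + \<delta>}")
        case True
        then have x: "x \<in> {0<..<1} - {x0}" "dist x x0 < e" using \<delta> x0 by (auto simp: dist_real_def)
        have "\<bar>U x0\<bar> / 2 \<le> \<bar>U x\<bar>"
          using e(2)[of x] x abs_triangle_ineq2[of "U x0" "U x"]
          by (auto simp: dist_real_def abs_minus_commute)
        then have "(\<bar>U x0\<bar> / 2)\<^sup>2 \<le> (u x)\<^sup>2"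
          using ux x by (metis DiffD1 abs_ge_zero abs_le_square_iff abs_of_nonneg divide_nonneg_pos zero_less_numeral)
        moreover have "0 < b x" "b x \<le> M * \<bar>x - x0\<bar>" using b(2)[OF x(1)] by auto
        ultimately have "(\<bar>U x0\<bar> / 2)\<^sup>2 / (M * \<bar>x - x0\<bar>) \<le> (u x)\<^sup>2 / b x"
          by (intro frac_le) auto
        then have "\<eta> * (1 / \<bar>x - x0\<bar>) \<le> norm ((u x)\<^sup>2 / b x)"
          unfolding \<eta>_def using \<open>0 < b x\<close> by simp
        then have "ennreal (\<eta> * (1 / \<bar>x - x0\<bar>)) \<le> ennreal (norm ((u x)\<^sup>2 / b x))" by (rule ennreal_leI)
        then show ?thesis using True x \<eta> by (simp add: ennreal_mult[symmetric])
      qed simp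
    qed
  qed
  also have "\<dots> = (\<integral>\<^sup>+x. ennreal (norm ((u x)\<^sup>2 / b x)) \<partial>lebesgue01)"
    by (simp add: nn_integral_restrict_space)
  also have "\<dots> < \<infinity>"
    using int unfolding integrable_iff_bounded by blast
  finally show False
    using nn_integral_reciprocal_eq_top[OF \<delta>(1), of x0] \<eta>
    by (subst (asm) nn_integral_cmult) (auto simp: ennreal_mult_top)
qed

section \<open>Assembly of the estimate for the degenerate coefficients\<close>

lemma W1inf_imp_W11: "u \<in> W1inf \<Longrightarrow> u \<in> W11"
  using Linf_imp_L1 by (auto simp: W1inf_def W11_def)

lemma L1_integral_bound_interval:
  assumes g: "g \<in> L1" and "0 \<le> p" "q \<le> 1" and sub: "{p<..<q} \<subseteq> S"
  shows "ennreal \<bar>integral {p..q} g\<bar>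
    \<le> (\<integral>\<^sup>+s. indicator S s * (indicator {0<..<1} s * ennreal \<bar>g s\<bar>) \<partial>lebesgue)"
  by (rule order.trans[OF L1_integral_bound[OF assms(1-3)]], rule nn_integral_mono)
    (use assms in \<open>auto simp: indicator_def\<close>)

text \<open>A Bochner integral defaults to 0 for a function that is not integrable. Integrability
  allows both sides of the final inequality to be converted to nonnegative extended
  integrals.\<close>

lemma H1ab_integrable:
  assumes u: "u \<in> H1ab a b" and pos: "\<And>x. x \<in> {0..1} - {x0} \<Longrightarrow> 0 < a x \<and> 0 < b x" and "a x0 = 0" "b x0 = 0"
  shows "integrable lebesgue01 (\<lambda>x. a x * (wderiv u x)\<^sup>2)" "integrable lebesgue01 (\<lambda>x. (u x)\<^sup>2 / b x)"
proof -
  have nonneg: "0 \<le> a x \<and> 0 \<le> b x" if "x \<in> {0<..<1}" for x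
    using pos[of x] that assms(3,4) by (cases "x = x0") (auto intro: less_imp_le)
  have "integrable lebesgue01 (\<lambda>x. (sqrt (a x) * wderiv u x)\<^sup>2)" "integrable lebesgue01 (\<lambda>x. (u x / sqrt (b x))\<^sup>2)"
    using u by (auto simp: H1ab_def H1a_def L2_def)
  moreover have "integrable lebesgue01 (\<lambda>x. (sqrt (a x) * wderiv u x)\<^sup>2) \<longleftrightarrow> integrable lebesgue01 (\<lambda>x. a x * (wderiv u x)\<^sup>2)"
    by (rule Bochner_Integration.integrable_cong) (use nonneg in \<open>auto simp: power_mult_distrib\<close>)
  moreover have "integrable lebesgue01 (\<lambda>x. (u x / sqrt (b x))\<^sup>2) \<longleftrightarrow> integrable lebesgue01 (\<lambda>x. (u x)\<^sup>2 / b x)"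
    by (rule Bochner_Integration.integrable_cong) (use nonneg in \<open>auto simp: power_divide\<close>)
  ultimately show "integrable lebesgue01 (\<lambda>x. a x * (wderiv u x)\<^sup>2)" "integrable lebesgue01 (\<lambda>x. (u x)\<^sup>2 / b x)"
    by auto
qed

lemma strictly_between_measurable:
  "Measurable.pred (lborel \<Otimes>\<^sub>M lborel) (\<lambda>(x, s). strictly_between c x s)"
  "Measurable.pred (lborel \<Otimes>\<^sub>M lborel) (\<lambda>(x, s). strictly_between c s x)"
  unfolding strictly_between_def by measurable

theorem proposition2p2:
  fixes a b :: "real \<Rightarrow> real" and x0 K1 K2 :: real
  assumes "WWD a b x0 K1 K2 \<or> WSD a b x0 K1 K2 \<or> SWD a b x0 K1 K2"
    and "K1 + K2 \<le> 2"
  shows "\<exists>C>0. \<forall>u\<in>H1ab a b.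
    (LINT x|lebesgue01. (u x)\<^sup>2 / b x) \<le> C * (LINT x|lebesgue01. a x * (wderiv u x)\<^sup>2)"
proof -
  have deg: "degenerate_at a b x0 K1 K2" and W: "a \<in> W11" "b \<in> W11" and K: "0 < K1" "0 < K2"
    \<comment> \<open>WWD and SWD share the first alternative; WSD gives the second, where
      \<open>b\<close> has a bounded weak derivative.\<close>
    and cases: "K2 < 1 \<or> K1 < 1 \<and> K2 \<ge> 1 \<and> b \<in> W1inf"
    using assms(1) W1inf_imp_W11 by (auto simp: WWD_def WSD_def SWD_def)
  have x0: "x0 \<in> {0<..<1}" and zero: "a x0 = 0" "b x0 = 0"
    and cont: "continuous_on {0..1} a" "continuous_on {0..1} b"
    and pos: "\<And>x. x \<in> {0..1} - {x0} \<Longrightarrow> 0 < a x \<and> 0 < b x"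
    and AE: "AE x in lebesgue_on {0..1}. (x - x0) * wderiv a x \<le> K1 * a x"
      "AE x in lebesgue_on {0..1}. (x - x0) * wderiv b x \<le> K2 * b x"
    using deg by (auto simp: degenerate_at_def)
  obtain c1 where c1: "0 < c1" "\<And>x. x \<in> {0<..<1} - {x0} \<Longrightarrow> c1 * \<bar>x - x0\<bar> powr K1 \<le> a x"
    using degenerate_lower_bound[OF W(1) cont(1) x0 K(1) _ AE(1)] pos by blast
  obtain c2 where c2: "0 < c2" "\<And>x. x \<in> {0<..<1} - {x0} \<Longrightarrow> c2 * \<bar>x - x0\<bar> powr K2 \<le> b x"
    using degenerate_lower_bound[OF W(2) cont(2) x0 K(2) _ AE(2)] pos by blast
  have primitive: "wderiv u \<in> L1" "AE x in lebesgue01. u x = integral {0..x} (wderiv u)" "integral {0..1} (wderiv u) = 0"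
    "\<And>p q. 0 \<le> p \<Longrightarrow> p \<le> q \<Longrightarrow> q \<le> 1 \<Longrightarrow> integral {0..q} (wderiv u) = integral {0..p} (wderiv u) + integral {p..q} (wderiv u)"
    if "u \<in> H1ab a b" for u
  proof -
    have "u \<in> W11_0" using that by (simp add: H1ab_def H1a_def)
    then show L1: "wderiv u \<in> L1" and "AE x in lebesgue01. u x = integral {0..x} (wderiv u)" "integral {0..1} (wderiv u) = 0"
      using W11_0_primitive wderiv_W11(1) by (auto simp: W11_0_def)
    show "integral {0..q} (wderiv u) = integral {0..p} (wderiv u) + integral {p..q} (wderiv u)"
      if "0 \<le> p" "p \<le> q" "q \<le> 1" for p q
      using that by (intro Henstock_Kurzweil_Integration.integral_combine[symmetric] L1_integrable_on[OF L1]) auto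
  qed
  have ne: "AE x in lebesgue01. x \<in> {0<..<1} - {x0}"
    using AE_completion[OF AE_lborel_singleton[of x0]] by (auto simp: AE_restrict_space_iff elim!: eventually_mono)
  from cases show ?thesis
  proof (elim disjE conjE)
    assume "K2 < 1"
    \<comment> \<open>With this exponent, \<open>K1 \<le> \<alpha>\<close> is precisely the
      assumption on \<open>K1 + K2\<close>.\<close>
    define \<alpha> where "\<alpha> = 2 - K2"
    have \<alpha>: "1 < \<alpha>" "K1 \<le> \<alpha>" "\<alpha> \<le> 2 - K2" using \<open>K2 < 1\<close> assms(2) by (auto simp: \<alpha>_def)
    show ?thesis
    proof (intro exI[of _ "4 / (1 - \<alpha>)\<^sup>2 / (c1 * c2)"] conjI ballI)
      show "4 / (1 - \<alpha>)\<^sup>2 / (c1 * c2) > 0" using \<alpha> c1 c2 by simp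
      fix u assume u: "u \<in> H1ab a b"
      note P = primitive[OF u]
      show "(LINT x|lebesgue01. (u x)\<^sup>2 / b x) \<le> 4 / (1 - \<alpha>)\<^sup>2 / (c1 * c2) * (LINT x|lebesgue01. a x * (wderiv u x)\<^sup>2)"
      proof (rule weighted_Hardy_inequality[OF strictly_between_measurable(2) Hardy_inequality_far[OF \<alpha>(1)]
            _ \<alpha>(2,3) c1(1) c2(1) x0 c1(2) c2(2) _ H1ab_integrable[OF u pos zero]])
        show "AE x in lebesgue01. ennreal \<bar>u x\<bar>
          \<le> (\<integral>\<^sup>+s. indicator {s. strictly_between x0 s x} s * (indicator {0<..<1} s * ennreal \<bar>wderiv u s\<bar>) \<partial>lebesgue)"
          using P(2) ne
        proof eventually_elim
          fix x assume x: "u x = integral {0..x} (wderiv u)" "x \<in> {0<..<1} - {x0}"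
          \<comment> \<open>As the total integral vanishes, \<open>u x\<close> can be computed from
            either end point. Taking the end point on the side of \<open>x\<close> keeps
            \<open>x\<close> strictly between \<open>x0\<close> and every interior point
            \<open>s\<close> of the path.\<close>
          have *: "\<bar>integral {0..x} (wderiv u)\<bar> = \<bar>integral {x..1} (wderiv u)\<bar>"
            using P(3) P(4)[of x 1] x(2) by simp
          show "ennreal \<bar>u x\<bar>
            \<le> (\<integral>\<^sup>+s. indicator {s. strictly_between x0 s x} s * (indicator {0<..<1} s * ennreal \<bar>wderiv u s\<bar>) \<partial>lebesgue)"
          proof (cases "x0 < x")
            case True
            show ?thesis unfolding x(1) *
              by (rule L1_integral_bound_interval[OF P(1)]) (use True x(2) in \<open>auto simp: strictly_between_def\<close>)
          next
            case False
            show ?thesis unfolding x(1)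
              by (rule L1_integral_bound_interval[OF P(1)]) (use False x(2) in \<open>auto simp: strictly_between_def\<close>)
          qed
        qed
      qed (use P(1) in \<open>auto simp: L1_def\<close>)
    qed
  next
    assume "K1 < 1" "1 \<le> K2" "b \<in> W1inf"
    have contb: "continuous_on {0<..<1} b"
      by (rule continuous_on_subset[OF cont(2)]) auto
    obtain M where M: "0 < M" "\<And>x y. x \<in> {0<..<1} \<Longrightarrow> y \<in> {0<..<1} \<Longrightarrow> \<bar>b x - b y\<bar> \<le> M * \<bar>x - y\<bar>"
      using W1inf_Lipschitz[OF \<open>b \<in> W1inf\<close> contb] by blast
    have bM: "0 < b x \<and> b x \<le> M * \<bar>x - x0\<bar>" if "x \<in> {0<..<1} - {x0}" for x
      using M(2)[of x x0] pos[of x] that x0 zero by auto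
    show ?thesis
    proof (intro exI[of _ "4 / (1 - K1)\<^sup>2 / (c1 * c2)"] conjI ballI)
      show "4 / (1 - K1)\<^sup>2 / (c1 * c2) > 0" using \<open>K1 < 1\<close> c1 c2 by simp
      fix u assume u: "u \<in> H1ab a b"
      note P = primitive[OF u]
      have "continuous_on {0..1} (\<lambda>x. integral {0..x} (wderiv u))"
        by (intro indefinite_integral_continuous_1 L1_integrable_on P(1)) auto
      \<comment> \<open>This allows the primitive to start at \<open>x0\<close>, so that only points
        strictly between \<open>x0\<close> and \<open>x\<close> enter the bound for
        \<open>u x\<close>.\<close>
      then have Ux0: "integral {0..x0} (wderiv u) = 0"
        by (rule primitive_vanishes_at_degeneracy[OF x0 _ P(2) M(1) bM H1ab_integrable(2)[OF u pos zero]])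
      show "(LINT x|lebesgue01. (u x)\<^sup>2 / b x) \<le> 4 / (1 - K1)\<^sup>2 / (c1 * c2) * (LINT x|lebesgue01. a x * (wderiv u x)\<^sup>2)"
      proof (rule weighted_Hardy_inequality[OF strictly_between_measurable(1) Hardy_inequality_near[OF \<open>K1 < 1\<close>]
            _ order.refl _ c1(1) c2(1) x0 c1(2) c2(2) _ H1ab_integrable[OF u pos zero]])
        show "AE x in lebesgue01. ennreal \<bar>u x\<bar>
          \<le> (\<integral>\<^sup>+s. indicator {s. strictly_between x0 x s} s * (indicator {0<..<1} s * ennreal \<bar>wderiv u s\<bar>) \<partial>lebesgue)"
          using P(2) ne
        proof eventually_elim
          fix x assume x: "u x = integral {0..x} (wderiv u)" "x \<in> {0<..<1} - {x0}"
          show "ennreal \<bar>u x\<bar>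
            \<le> (\<integral>\<^sup>+s. indicator {s. strictly_between x0 x s} s * (indicator {0<..<1} s * ennreal \<bar>wderiv u s\<bar>) \<partial>lebesgue)"
          proof (cases "x0 < x")
            case True
            have "u x = integral {x0..x} (wderiv u)"
              using P(4)[of x0 x] Ux0 x x0 True by simp
            show ?thesis unfolding \<open>u x = integral {x0..x} (wderiv u)\<close>
              by (rule L1_integral_bound_interval[OF P(1)]) (use True x(2) x0 in \<open>auto simp: strictly_between_def\<close>)
          next
            case False
            have "\<bar>u x\<bar> = \<bar>integral {x..x0} (wderiv u)\<bar>"
              using P(4)[of x x0] Ux0 x x0 False by simp
            show ?thesis unfolding \<open>\<bar>u x\<bar> = \<bar>integral {x..x0} (wderiv u)\<bar>\<close>
              by (rule L1_integral_bound_interval[OF P(1)]) (use False x(2) x0 in \<open>auto simp: strictly_between_def\<close>)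
          qed
        qed
      qed (use P(1) assms(2) in \<open>auto simp: L1_def\<close>)
    qed
  qed
qed

end
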